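(* Let $\gamma\subset\mathbb{C}$ be a closed Ahlfors-regular Jordan curve with diameter $d$ which is a Král curve. Then there is a constant $c>0$ depending only on $\gamma$ such that for every continuous function $g:\gamma\to\mathbb{R}$ and for each choice of the sign $\pm$, $$\omega_{\overline{D^{\pm}}}\Big(\big({\rm Re}\,\widetilde{g}\big)^{\pm},\varepsilon\Big)\le c\,\varepsilon\int_{\varepsilon}^{2d}\frac{\omega_{\gamma}(g,\eta)}{\eta^2}\,d\eta\qquad\text{for all }\varepsilon\in(0,d/8].$$
   Context: Let $\gamma$ be a closed rectifiable Jordan curve in $\mathbb{C}$, oriented counterclockwise, with interior domain $D^+$ and exterior domain $D^-$, and diameter $d:=\max_{t_1,t_2\in\gamma}|t_1-t_2|$. Closures $\overline{D^\pm}$ are taken in $\mathbb{C}$. For $x\in\gamma$ and $\varepsilon>0$ put $\gamma_\varepsilon(x):=\{t\in\gamma:|t-x|\le\varepsilon\}$ and $\theta_x(\varepsilon):=\mathrm{mes}\,\gamma_\varepsilon(x)$, where $\mathrm{mes}$ is the linear Lebesgue (arc length) measure on $\gamma$. The curve $\gamma$ is Ahlfors-regular if $\sup_{x\in\gamma}\theta_x(\varepsilon)=O(\varepsilon)$ as $\varepsilon\to0$. Branch of the argument. For $\xi\in\gamma$ and $0<\delta<d/2$ let $\gamma_{\xi,\delta}$ be the connected component of $\gamma_\delta(\xi)$ containing $\xi$. Choose $\xi_1\in\gamma_{\xi,\delta}$ at which $\gamma$ has a tangent and which does not precede $\xi$ in the orientation of $\gamma$. Cut the plane along $\gamma[\xi,\xi_1]\cup\Gamma[\xi_1,\infty]$,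 where $\gamma[\xi,\xi_1]$ is the arc of $\gamma$ from $\xi$ to $\xi_1$ and $\Gamma[\xi_1,\infty]$ is a smooth curve joining $\xi_1$ to $\infty$ that lies in $D^-$ except for its ends. Let $\arg_\delta(z-\xi)$ be the branch of $\mathrm{Arg}(z-\xi)$ continuous off the cut with $\arg_\delta(z_0-\xi)=\phi_0$, where $z_0\in D^+$ and the value $\phi_0$ of $\mathrm{Arg}(z_0-\xi)$ are fixed for all $\delta$. Then $\arg(t-\xi):=\lim_{\delta\to0^+}\arg_\delta(t-\xi)$ for $t\in\gamma\setminus\{\xi\}$; this is a branch continuous on $\gamma\setminus\{\xi\}$. The curve $\gamma$ is a Král curve if, for every $\xi\in\gamma$, the function $t\mapsto\arg(t-\xi)$ has bounded variation $V_\gamma[\arg(t-\xi)]$ on $\gamma\setminus\{\xi\}$ and $\sup_{\xi\in\gamma}V_\gamma[\arg(t-\xi)]<\infty$. (Equivalently, $\sup_{\xi\in\gamma}\int_0^{2\pi}\mu_\gamma(\xi,\phi)\,d\phi<\infty$, where $\mu_\gamma(\xi,\phi)$ is the number of intersection points of $\gamma$ with the ray $\{\xi+re^{i\phi}:r>0\}$.) The Cauchy-type integral is $\widetilde g(z):=\frac{1}{2\pi i}\int_\gamma\frac{g(t)}{t-z}\,dt$ for $z\in D^\pm$. It is known (Král) that for a Král curve and any continuous $g:\gamma\to\mathbb{R}$, the function ${\rm Re}\,\widetilde g$ extends continuously from $D^+$ and from $D^-$ to $\gamma$. The continuous extensions of ${\rm Re}\,\widetilde g$ from $D^\pm$ to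 $\overline{D^\pm}$ are denoted $({\rm Re}\,\widetilde g)^\pm$. For $f:E\to\mathbb{C}$ continuous on $E\subset\mathbb{C}$, the modulus of continuity is $\omega_E(f,\varepsilon):=\sup\{|f(t_1)-f(t_2)|:t_1,t_2\in E,\ |t_1-t_2|\le\varepsilon\}$. *)

theory Defs
  imports "HOL-Complex_Analysis.Complex_Analysis" "HOL-Library.Landau_Symbols"
begin

section \<open>Rectifiable Jordan curves\<close>

definition total_variation_on :: "real set \<Rightarrow> (real \<Rightarrow> 'a::metric_space) \<Rightarrow> ennreal" where
  "total_variation_on S f =
     (SUP xs \<in> {xs. sorted xs \<and> set xs \<subseteq> S}.
        ennreal (\<Sum>i<length xs - 1. dist (f (xs ! i)) (f (xs ! Suc i))))"

definition arc_length :: "(real \<Rightarrow> complex) \<Rightarrow> real \<Rightarrow> real" where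
  "arc_length \<gamma> s = enn2real (total_variation_on {0..s} \<gamma>)"

text \<open>The parametrisation is an arbitrary continuous one of finite length; it need not be
  differentiable anywhere.\<close>

definition rectifiable_Jordan_curve :: "(real \<Rightarrow> complex) \<Rightarrow> bool" where
  "rectifiable_Jordan_curve \<gamma> \<longleftrightarrow>
     simple_path \<gamma> \<and> pathfinish \<gamma> = pathstart \<gamma> \<and> total_variation_on {0..1} \<gamma> < \<infinity>"

definition counterclockwise :: "(real \<Rightarrow> complex) \<Rightarrow> bool" where
  "counterclockwise \<gamma> \<longleftrightarrow> (\<forall>z \<in> inside (path_image \<gamma>). winding_number \<gamma> z = 1)"

text \<open>The linear measure of \<open>A \<inter> \<gamma>\<close>: the Lebesgue measure of the corresponding set of
  arc-length parameters.\<close>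

definition mes :: "(real \<Rightarrow> complex) \<Rightarrow> complex set \<Rightarrow> real" where
  "mes \<gamma> A = measure lebesgue (arc_length \<gamma> ` {s \<in> {0..1}. \<gamma> s \<in> A})"

definition curve_nbhd :: "(real \<Rightarrow> complex) \<Rightarrow> real \<Rightarrow> complex \<Rightarrow> complex set" where
  "curve_nbhd \<gamma> \<epsilon> x = {t \<in> path_image \<gamma>. cmod (t - x) \<le> \<epsilon>}"

definition Ahlfors_regular :: "(real \<Rightarrow> complex) \<Rightarrow> bool" where
  "Ahlfors_regular \<gamma> \<longleftrightarrow>
     (\<lambda>\<epsilon>. SUP x \<in> path_image \<gamma>. mes \<gamma> (curve_nbhd \<gamma> \<epsilon> x)) \<in> O[at_right 0](\<lambda>\<epsilon>. \<epsilon>)"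


section \<open>The branch of the argument and Kral curves\<close>

text \<open>The closed curve, traversed once in its own orientation starting and ending at \<open>\<xi>\<close>.\<close>

definition curve_from :: "(real \<Rightarrow> complex) \<Rightarrow> complex \<Rightarrow> real \<Rightarrow> complex" where
  "curve_from \<gamma> \<xi> = shiftpath (inv_into {0..1} \<gamma> \<xi>) \<gamma>"

text \<open>Tangency is a property of the oriented curve, independent of the parametrisation: chords
  leaving the point and chords arriving at it have the same limiting direction \<open>\<tau>\<close>.\<close>

definition has_tangent_at :: "(real \<Rightarrow> complex) \<Rightarrow> complex \<Rightarrow> bool" where
  "has_tangent_at \<gamma> x \<longleftrightarrow>
     (\<exists>\<tau>. cmod \<tau> = 1 \<and>
        ((\<lambda>s. sgn (curve_from \<gamma> x s - x)) \<longlongrightarrow> \<tau>) (at_right 0) \<and>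
        ((\<lambda>s. sgn (x - curve_from \<gamma> x s)) \<longlongrightarrow> \<tau>) (at_left 1))"

definition smooth_curve_to_infinity :: "complex \<Rightarrow> complex set \<Rightarrow> (real \<Rightarrow> complex) \<Rightarrow> bool" where
  "smooth_curve_to_infinity x D h \<longleftrightarrow>
     h 0 = x \<and> (\<forall>s>0. h s \<in> D) \<and> inj_on h {0..} \<and> filterlim h at_infinity at_top \<and>
     (\<exists>h'. continuous_on {0..} h' \<and>
        (\<forall>s\<ge>0. h' s \<noteq> 0 \<and> (h has_vector_derivative h' s) (at s within {0..})))"

text \<open>In \<open>argument_cut \<gamma> \<xi> \<delta> C\<close> the endpoint \<open>\<xi>\<^sub>1\<close> is \<open>curve_from \<gamma> \<xi> u\<close>. For \<open>\<delta> < d / 2\<close> the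
  component is a proper subarc, so \<open>\<xi>\<^sub>1\<close> lies in it and does not precede \<open>\<xi>\<close> iff the whole arc
  traversed from \<open>\<xi>\<close> to \<open>\<xi>\<^sub>1\<close> lies in it; \<open>u = 0\<close>, i.e. \<open>\<xi>\<^sub>1 = \<xi>\<close>, is allowed.\<close>

definition argument_cut :: "(real \<Rightarrow> complex) \<Rightarrow> complex \<Rightarrow> real \<Rightarrow> complex set \<Rightarrow> bool" where
  "argument_cut \<gamma> \<xi> \<delta> C \<longleftrightarrow>
     (\<exists>u h. 0 \<le> u \<and> u < 1 \<and>
        curve_from \<gamma> \<xi> ` {0..u} \<subseteq> connected_component_set (curve_nbhd \<gamma> \<delta> \<xi>) \<xi> \<and>
        has_tangent_at \<gamma> (curve_from \<gamma> \<xi> u) \<and>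
        smooth_curve_to_infinity (curve_from \<gamma> \<xi> u) (outside (path_image \<gamma>)) h \<and>
        C = curve_from \<gamma> \<xi> ` {0..u} \<union> h ` {0..})"

definition arg_delta_branch ::
  "(real \<Rightarrow> complex) \<Rightarrow> complex \<Rightarrow> complex \<Rightarrow> real \<Rightarrow> real \<Rightarrow> (complex \<Rightarrow> real) \<Rightarrow> bool" where
  "arg_delta_branch \<gamma> \<xi> z\<^sub>0 \<phi>\<^sub>0 \<delta> A \<longleftrightarrow>
     (\<exists>C. argument_cut \<gamma> \<xi> \<delta> C \<and> continuous_on (- C) A \<and>
          (\<forall>z \<in> - C. is_Arg (z - \<xi>) (A z)) \<and> A z\<^sub>0 = \<phi>\<^sub>0)"

text \<open>\<open>arg_branch \<gamma> \<xi> a\<close>: the function \<open>a\<close> is a branch \<open>t \<mapsto> arg (t - \<xi>)\<close> on \<open>\<gamma> - {\<xi>}\<close>. The values of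
  \<open>A \<delta>\<close> on its cut are irrelevant: a given \<open>t \<noteq> \<xi>\<close> is off the cut as soon as
  \<open>\<delta> < cmod (t - \<xi>)\<close>.\<close>

definition arg_branch :: "(real \<Rightarrow> complex) \<Rightarrow> complex \<Rightarrow> (complex \<Rightarrow> real) \<Rightarrow> bool" where
  "arg_branch \<gamma> \<xi> a \<longleftrightarrow>
     (\<exists>z\<^sub>0 \<in> inside (path_image \<gamma>). \<exists>\<phi>\<^sub>0 A. is_Arg (z\<^sub>0 - \<xi>) \<phi>\<^sub>0 \<and>
        (\<forall>\<delta>. 0 < \<delta> \<and> \<delta> < diameter (path_image \<gamma>) / 2 \<longrightarrow> arg_delta_branch \<gamma> \<xi> z\<^sub>0 \<phi>\<^sub>0 \<delta> (A \<delta>)) \<and>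
        (\<forall>t \<in> path_image \<gamma> - {\<xi>}. ((\<lambda>\<delta>. A \<delta> t) \<longlongrightarrow> a t) (at_right 0)))"

text \<open>The variation over \<open>\<gamma> - {\<xi>}\<close>, whose points are \<open>curve_from \<gamma> \<xi> s\<close> with \<open>0 < s < 1\<close>.\<close>

definition punctured_variation :: "(real \<Rightarrow> complex) \<Rightarrow> complex \<Rightarrow> (complex \<Rightarrow> real) \<Rightarrow> ennreal" where
  "punctured_variation \<gamma> \<xi> a = total_variation_on {0<..<1} (\<lambda>s. a (curve_from \<gamma> \<xi> s))"

text \<open>For given \<open>\<xi>\<close> the branch is unique up to an additive constant, so its variation does not
  depend on which branch \<open>a \<xi>\<close> is taken.\<close>

definition Kral_curve :: "(real \<Rightarrow> complex) \<Rightarrow> bool" where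
  "Kral_curve \<gamma> \<longleftrightarrow>
     (\<exists>a. (\<forall>\<xi> \<in> path_image \<gamma>. arg_branch \<gamma> \<xi> (a \<xi>)) \<and>
          (SUP \<xi> \<in> path_image \<gamma>. punctured_variation \<gamma> \<xi> (a \<xi>)) < \<infinity>)"


section \<open>The Cauchy-type integral\<close>

text \<open>The integral over a rectifiable curve is the limit of Riemann-Stieltjes sums.
  The library's \<open>contour_integral\<close> is based on the derivative of the parametrisation and gives a
  wrong value for rectifiable paths that are not absolutely continuous.\<close>

definition has_curve_integral ::
  "(complex \<Rightarrow> complex) \<Rightarrow> complex \<Rightarrow> (real \<Rightarrow> complex) \<Rightarrow> bool" where
  "has_curve_integral f I \<gamma> \<longleftrightarrow>
     (\<forall>e>0. \<exists>d>0. \<forall>\<D>. \<D> tagged_division_of {0..1} \<and> (\<lambda>s. ball s d) fine \<D> \<longrightarrow>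
        cmod ((\<Sum>(s, K)\<in>\<D>. f (\<gamma> s) * (\<gamma> (Sup K) - \<gamma> (Inf K))) - I) < e)"

definition curve_integral :: "(real \<Rightarrow> complex) \<Rightarrow> (complex \<Rightarrow> complex) \<Rightarrow> complex" where
  "curve_integral \<gamma> f = (THE I. has_curve_integral f I \<gamma>)"

definition cauchy_type_integral :: "(real \<Rightarrow> complex) \<Rightarrow> (complex \<Rightarrow> real) \<Rightarrow> complex \<Rightarrow> complex" where
  "cauchy_type_integral \<gamma> g z =
     1 / (2 * of_real pi * \<i>) * curve_integral \<gamma> (\<lambda>t. of_real (g t) / (t - z))"

text \<open>On \<open>closure D\<close> this is the continuous extension of \<open>f\<close> from \<open>D\<close>, whenever there is one.\<close>

definition continuous_extension ::
  "complex set \<Rightarrow> (complex \<Rightarrow> real) \<Rightarrow> complex \<Rightarrow> real" where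
  "continuous_extension D f z = (if z \<in> D then f z else Lim (at z within D) f)"

definition modulus_of_continuity ::
  "complex set \<Rightarrow> (complex \<Rightarrow> 'a::metric_space) \<Rightarrow> real \<Rightarrow> ennreal" where
  "modulus_of_continuity E f \<epsilon> =
     (SUP (t\<^sub>1, t\<^sub>2) \<in> {(t\<^sub>1, t\<^sub>2). t\<^sub>1 \<in> E \<and> t\<^sub>2 \<in> E \<and> cmod (t\<^sub>1 - t\<^sub>2) \<le> \<epsilon>}.
        ennreal (dist (f t\<^sub>1) (f t\<^sub>2)))"

end

theory Submission
  imports Defs
begin

text \<open>Everything is estimated on the polygons inscribed in the curve at the uniform partitions, so that
  no differentiability of the curve enters. With vertices \<open>t\<^sub>i\<close> and edges \<open>e\<^sub>i\<close>, the variation of the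
  argument about \<open>\<xi>\<close> controls \<open>\<Sum>\<bar>Im (e\<^sub>i / (t\<^sub>i - \<xi>))\<bar>\<close>, and by regularity this bound, assumed for \<open>\<xi>\<close> on
  the curve, passes to all points off it. For two points \<open>z\<^sub>1, z\<^sub>2\<close> of the domain at distance at most
  \<open>\<epsilon>\<close> let \<open>x\<close> be the point of the curve nearest to \<open>z\<^sub>1\<close>. Both points have the same winding number, so
  \<open>g\<close> may be replaced by \<open>g - g x\<close> in the difference of the two integrals. Edges within \<open>4\<epsilon>\<close> of
  \<open>x\<close> contribute \<open>O(\<omega>(4\<epsilon>))\<close> by the variation bound; the others contribute
  \<open>O(\<epsilon> \<Sum> \<omega>(r\<^sub>i) \<bar>e\<^sub>i\<bar> / r\<^sub>i\<^sup>2)\<close> with \<open>r\<^sub>i = \<bar>t\<^sub>i - x\<bar>\<close>, which regularity turns into the integral of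
  \<open>\<omega>(\<eta>) / \<eta>\<^sup>2\<close>. The estimate makes the real part uniformly continuous on the domain, hence it
  extends to the closure with the same bound.\<close>

section \<open>Variation along partitions\<close>

text \<open>Since \<open>g\<close> is real, the factor 1/(2 pi i) turns the real part of the
  Cauchy-type integral into an integral of \<open>g\<close> against Im dt/(t - z), the differential
  of arg(t - z). This makes the near part bounded: the sum of |e_i| / |t_i - z| over edges close to
  z can grow like the logarithm of the distance of z to the curve, whereas the argument has bounded
  variation. The Kral bound concerns centres on the curve, where the edges next to the centre have
  to be left out; the poles of the Cauchy-type integrals lie off the curve, arbitrarily close to it.
  The transfer therefore has to give a constant that does not depend on the distance of the pole,
  and regularity is what cancels this distance. Every bound is independent of the number n of edges
  and holds once n is large enough for the points in question, so that it survives the passage to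
  the limit of the sums.\<close>

fun chord_sum :: "(real \<Rightarrow> 'a::metric_space) \<Rightarrow> real list \<Rightarrow> real" where
  "chord_sum f [] = 0"
| "chord_sum f [x] = 0"
| "chord_sum f (x # y # zs) = dist (f x) (f y) + chord_sum f (y # zs)"

text \<open>The recursion gives the polygon length that defines \<open>total_variation_on\<close> in
  a form suited to induction on the list of parameters.\<close>

lemma chord_sum_eq: "chord_sum f xs = (\<Sum>i<length xs - 1. dist (f (xs ! i)) (f (xs ! Suc i)))"
proof (induction f xs rule: chord_sum.induct)
  case (3 f x y zs)
  then show ?case by (simp add: sum.lessThan_Suc_shift del: sum.lessThan_Suc)
qed auto

lemma chord_sum_append:
  "chord_sum f (xs @ a # ys) = chord_sum f (xs @ [a]) + chord_sum f (a # ys)"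
proof (induction xs)
  case (Cons x xs)
  then show ?case by (cases xs) auto
qed auto

text \<open>By the triangle inequality an extra interior vertex never shortens a polygon; an extra
  end point only adds a segment.\<close>

lemma chord_sum_insert_mid: "chord_sum f (xs @ ys) \<le> chord_sum f (xs @ a # ys)"
proof (induction xs)
  case Nil
  show ?case by (cases ys) auto
next
  case (Cons x xs)
  show ?case
  proof (cases xs)
    case Nil
    show ?thesis
    proof (cases ys)
      case (Cons y zs)
      with Nil show ?thesis using dist_triangle[of "f x" "f y" "f a"] by simp
    qed (use Nil in simp)
  qed (use Cons in auto)
qed

lemma total_variation_on_chord_sum:
  "total_variation_on S f = (SUP xs \<in> {xs. sorted xs \<and> set xs \<subseteq> S}. ennreal (chord_sum f xs))"
  by (simp add: total_variation_on_def chord_sum_eq)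

lemma chord_sum_le_total_variation:
  "sorted xs \<Longrightarrow> set xs \<subseteq> S \<Longrightarrow> ennreal (chord_sum f xs) \<le> total_variation_on S f"
  unfolding total_variation_on_chord_sum by (rule SUP_upper) auto

lemma total_variation_on_mono: "S \<subseteq> T \<Longrightarrow> total_variation_on S f \<le> total_variation_on T f"
  unfolding total_variation_on_chord_sum by (rule SUP_subset_mono) auto

text \<open>The cells in \<open>I\<close> need not be adjacent, which is what sums over edges away
  from a point require. Their end points are collected from left to right, and the chords bridging
  the gaps only enlarge the sum.\<close>

lemma partition_variation_le:
  fixes p :: "nat \<Rightarrow> real"
  assumes mono: "mono p" and I: "\<And>i. i \<in> I \<Longrightarrow> p i \<in> S \<and> p (Suc i) \<in> S"
  shows "ennreal (\<Sum>i\<in>I \<inter> {..<n}. dist (f (p i)) (f (p (Suc i)))) \<le> total_variation_on S f"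
proof -
  \<comment> \<open>The bound by \<open>p n\<close> keeps the list sorted when \<open>p n\<close>
    and \<open>p (Suc n)\<close> are appended.\<close>
  have "\<exists>xs. sorted xs \<and> set xs \<subseteq> S \<and> (\<forall>x\<in>set xs. x \<le> p n) \<and>
          (\<Sum>i\<in>I \<inter> {..<n}. dist (f (p i)) (f (p (Suc i)))) \<le> chord_sum f xs"
  proof (induction n)
    case 0
    show ?case by (rule exI[of _ "[]"]) simp
  next
    case (Suc n)
    then obtain xs where xs: "sorted xs" "set xs \<subseteq> S" "\<forall>x\<in>set xs. x \<le> p n"
      "(\<Sum>i\<in>I \<inter> {..<n}. dist (f (p i)) (f (p (Suc i)))) \<le> chord_sum f xs" by blast
    have pn: "p n \<le> p (Suc n)" using mono by (simp add: monoD)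
    show ?case
    proof (cases "n \<in> I")
      case True
      have eq: "I \<inter> {..<Suc n} = insert n (I \<inter> {..<n})" using True by auto
      have "chord_sum f xs \<le> chord_sum f (xs @ [p n])"
        using chord_sum_insert_mid[of f xs "[]" "p n"] by simp
      moreover have "chord_sum f (xs @ [p n, p (Suc n)]) =
          chord_sum f (xs @ [p n]) + dist (f (p n)) (f (p (Suc n)))"
        using chord_sum_append[of f xs "p n" "[p (Suc n)]"] by simp
      ultimately have "(\<Sum>i\<in>I \<inter> {..<Suc n}. dist (f (p i)) (f (p (Suc i))))
          \<le> chord_sum f (xs @ [p n, p (Suc n)])"
        unfolding eq using xs(4) by simp
      moreover have "sorted (xs @ [p n, p (Suc n)])"
        using xs(1,3) pn by (fastforce simp: sorted_append)
      ultimately show ?thesis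
        using I[OF True] xs pn by (intro exI[of _ "xs @ [p n, p (Suc n)]"]) fastforce
    next
      case False
      then have "I \<inter> {..<Suc n} = I \<inter> {..<n}" by (auto simp: less_Suc_eq)
      then show ?thesis using xs pn by (intro exI[of _ xs]) fastforce
    qed
  qed
  then show ?thesis
    by (meson chord_sum_le_total_variation ennreal_leI order_trans)
qed

section \<open>Arc length\<close>

locale rectifiable_curve =
  fixes \<gamma> :: "real \<Rightarrow> complex"
  assumes curve: "rectifiable_Jordan_curve \<gamma>"
begin

lemma cont: "continuous_on {0..1} \<gamma>"
  using curve by (simp add: rectifiable_Jordan_curve_def simple_path_def path_def)

lemma simple: "simple_path \<gamma>" and closed_curve: "pathfinish \<gamma> = pathstart \<gamma>"
  using curve by (simp_all add: rectifiable_Jordan_curve_def)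

lemma total_variation_finite: "b \<le> 1 \<Longrightarrow> total_variation_on {0..b} \<gamma> < \<infinity>"
  using curve total_variation_on_mono[of "{0..b}" "{0..1}" \<gamma>]
  by (auto simp: rectifiable_Jordan_curve_def intro: le_less_trans)

lemma arc_length_nonneg: "0 \<le> arc_length \<gamma> s"
  by (simp add: arc_length_def)

lemma chord_sum_le_arc_length:
  assumes "sorted xs" "set xs \<subseteq> {0..b}" "b \<le> 1"
  shows "chord_sum \<gamma> xs \<le> arc_length \<gamma> b"
proof -
  have "ennreal (chord_sum \<gamma> xs) \<le> ennreal (arc_length \<gamma> b)"
    using chord_sum_le_total_variation[OF assms(1,2), of \<gamma>] total_variation_finite[OF assms(3)]
    by (simp add: arc_length_def)
  then show ?thesis by (simp add: arc_length_nonneg)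
qed

lemma arc_length_le:
  assumes "\<And>xs. sorted xs \<Longrightarrow> set xs \<subseteq> {0..b} \<Longrightarrow> chord_sum \<gamma> xs \<le> B"
  shows "arc_length \<gamma> b \<le> B"
proof -
  have "0 \<le> B" using assms[of "[]"] by simp
  moreover have "total_variation_on {0..b} \<gamma> \<le> ennreal B"
    unfolding total_variation_on_chord_sum by (rule SUP_least) (auto intro!: ennreal_leI assms)
  ultimately show ?thesis unfolding arc_length_def by (rule enn2real_leI)
qed

text \<open>Superadditivity of length: a polygon on \<open>{0..a}\<close> continued by the one
  starting at \<open>a\<close> is a polygon on \<open>{0..b}\<close>. A single segment gives that a
  chord is no longer than its arc.\<close>

lemma chord_sum_le_arc_length_diff:
  assumes "0 \<le> a" "b \<le> 1" "sorted (a # ys)" "set ys \<subseteq> {0..b}" "a \<le> b"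
  shows "chord_sum \<gamma> (a # ys) \<le> arc_length \<gamma> b - arc_length \<gamma> a"
proof -
  have "arc_length \<gamma> a \<le> arc_length \<gamma> b - chord_sum \<gamma> (a # ys)"
  proof (rule arc_length_le)
    fix xs assume xs: "sorted xs" "set xs \<subseteq> {0..a}"
    have "chord_sum \<gamma> (xs @ a # ys) \<le> arc_length \<gamma> b"
    proof (rule chord_sum_le_arc_length)
      have "x \<le> y" if "x \<in> set xs" "y \<in> set (a # ys)" for x y
      proof -
        have "x \<le> a" using that(1) xs(2) by auto
        moreover have "a \<le> y" using that(2) assms(3) by auto
        ultimately show ?thesis by simp
      qed
      then show "sorted (xs @ a # ys)" using xs(1) assms(3) by (simp only: sorted_append) blast
      show "set (xs @ a # ys) \<subseteq> {0..b}" 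
      proof -
        have "set xs \<subseteq> {0..b}" using xs(2) assms(5) by (meson atLeastatMost_subset_iff order_refl order_trans)
        then show ?thesis using assms(1,4,5) by simp
      qed
    qed (use assms in simp)
    moreover have "chord_sum \<gamma> xs \<le> chord_sum \<gamma> (xs @ [a])"
      using chord_sum_insert_mid[of \<gamma> xs "[]" a] by simp
    ultimately show "chord_sum \<gamma> xs \<le> arc_length \<gamma> b - chord_sum \<gamma> (a # ys)"
      using chord_sum_append[of \<gamma> xs a ys] by simp
  qed
  then show ?thesis by simp
qed

lemma chord_le_arc_length:
  assumes "0 \<le> a" "a \<le> b" "b \<le> 1"
  shows "cmod (\<gamma> b - \<gamma> a) \<le> arc_length \<gamma> b - arc_length \<gamma> a"
  using chord_sum_le_arc_length_diff[of a b "[b]"] assms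
  by (simp add: dist_norm norm_minus_commute)

lemma arc_length_mono: "0 \<le> a \<Longrightarrow> a \<le> b \<Longrightarrow> b \<le> 1 \<Longrightarrow> arc_length \<gamma> a \<le> arc_length \<gamma> b"
  using chord_le_arc_length[of a b] norm_ge_zero[of "\<gamma> b - \<gamma> a"] by linarith

text \<open>For a polygon whose length is within \<open>e\<close> of the total, every arc free of interior vertices
  exceeds its chord by at most \<open>e\<close>.\<close>

lemma arc_length_almost_chord:
  assumes "e > 0"
  obtains F where "finite F" "\<And>a b. 0 \<le> a \<Longrightarrow> a \<le> b \<Longrightarrow> b \<le> 1 \<Longrightarrow> F \<inter> {a<..<b} = {} \<Longrightarrow>
    arc_length \<gamma> b - arc_length \<gamma> a \<le> cmod (\<gamma> b - \<gamma> a) + e"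
proof -
  have "\<exists>xs. sorted xs \<and> set xs \<subseteq> {0..1} \<and> arc_length \<gamma> 1 - e < chord_sum \<gamma> xs"
  proof (rule ccontr)
    assume "\<not> ?thesis"
    then have "arc_length \<gamma> 1 \<le> arc_length \<gamma> 1 - e"
      by (intro arc_length_le) (meson not_le)
    with assms show False by simp
  qed
  then obtain xs where xs: "sorted xs" "set xs \<subseteq> {0..1}" "arc_length \<gamma> 1 - e < chord_sum \<gamma> xs"
    by blast
  show thesis
  proof (rule that[of "set xs"])
    fix a b :: real assume ab: "0 \<le> a" "a \<le> b" "b \<le> 1" "set xs \<inter> {a<..<b} = {}"
    define ys where "ys = takeWhile (\<lambda>x. x \<le> a) xs"
    define zs where "zs = dropWhile (\<lambda>x. x \<le> a) xs"
    have xsE: "xs = ys @ zs" by (simp add: ys_def zs_def)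
    have ys: "sorted ys" "set ys \<subseteq> {0..a}"
      using xs(1,2) by (auto simp: xsE sorted_append) (auto simp: ys_def dest: set_takeWhileD)
    have zs: "sorted (b # zs)" "set zs \<subseteq> {0..1}"
    proof -
      have srt: "sorted zs" using xs(1) by (simp add: xsE sorted_append)
      have "b \<le> z" if z: "z \<in> set zs" for z
      proof -
        obtain w ws where w: "zs = w # ws" using z by (cases zs) auto
        then have "a < w" unfolding zs_def by (metis dropWhile_eq_Cons_conv not_le)
        then have "a < z" using srt z w by auto
        moreover have "z \<in> set xs" using z xsE by simp
        ultimately show ?thesis using ab(4) by (meson disjoint_iff greaterThanLessThan_iff not_le)
      qed
      then show "sorted (b # zs)" using srt by simp
      show "set zs \<subseteq> {0..1}" using xs(2) by (simp add: xsE)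
    qed
    have "chord_sum \<gamma> xs \<le> chord_sum \<gamma> (ys @ a # b # zs)"
      unfolding xsE using chord_sum_insert_mid[of \<gamma> ys zs b] chord_sum_insert_mid[of \<gamma> ys "b # zs" a]
      by simp
    also have "\<dots> = chord_sum \<gamma> (ys @ [a]) + dist (\<gamma> a) (\<gamma> b) + chord_sum \<gamma> (b # zs)"
      using chord_sum_append[of \<gamma> ys a "b # zs"] by simp
    also have "chord_sum \<gamma> (ys @ [a]) \<le> arc_length \<gamma> a"
      using ys ab by (intro chord_sum_le_arc_length) (auto simp: sorted_append)
    also have "chord_sum \<gamma> (b # zs) \<le> arc_length \<gamma> 1 - arc_length \<gamma> b"
      using zs ab by (intro chord_sum_le_arc_length_diff) auto
    finally show "arc_length \<gamma> b - arc_length \<gamma> a \<le> cmod (\<gamma> b - \<gamma> a) + e"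
      using xs(3) by (simp add: dist_norm norm_minus_commute)
  qed simp
qed

lemma continuous_on_arc_length: "continuous_on {0..1} (arc_length \<gamma>)"
  unfolding continuous_on_iff
proof (intro ballI allI impI)
  fix c e :: real assume c: "c \<in> {0..1}" and e: "e > 0"
  obtain F where F: "finite F" "\<And>a b. 0 \<le> a \<Longrightarrow> a \<le> b \<Longrightarrow> b \<le> 1 \<Longrightarrow> F \<inter> {a<..<b} = {} \<Longrightarrow>
    arc_length \<gamma> b - arc_length \<gamma> a \<le> cmod (\<gamma> b - \<gamma> a) + e / 2"
    using arc_length_almost_chord[of "e / 2"] e by auto
  obtain d1 where d1: "d1 > 0" "\<And>x. x \<in> {0..1} \<Longrightarrow> dist x c < d1 \<Longrightarrow> dist (\<gamma> x) (\<gamma> c) < e / 2"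
    using cont e c unfolding continuous_on_iff by (metis half_gt_zero)
  \<comment> \<open>Closer to \<open>c\<close> than \<open>d2\<close> there is no vertex except
    possibly \<open>c\<close>, which is an end point of the arc between \<open>c\<close> and
    \<open>x\<close> and so not interior to it.\<close>
  obtain d2 where d2: "d2 > 0" "\<forall>x\<in>F. x \<noteq> c \<longrightarrow> d2 \<le> dist c x"
    using finite_set_avoid[OF F(1)] by metis
  show "\<exists>d>0. \<forall>x\<in>{0..1}. dist x c < d \<longrightarrow> dist (arc_length \<gamma> x) (arc_length \<gamma> c) < e"
  proof (intro exI[of _ "min d1 d2"] conjI ballI impI)
    fix x assume x: "x \<in> {0..1}" "dist x c < min d1 d2"
    define a where "a = min x c"
    define b where "b = max x c"
    have ab: "0 \<le> a" "a \<le> b" "b \<le> 1" using x c by (auto simp: a_def b_def)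
    have "F \<inter> {a<..<b} = {}"
    proof -
      have False if "y \<in> F" "a < y" "y < b" for y
        using d2(2) that x(2) unfolding a_def b_def dist_real_def by (fastforce split: if_splits)
      then show ?thesis by auto
    qed
    with F(2) ab have "arc_length \<gamma> b - arc_length \<gamma> a \<le> cmod (\<gamma> b - \<gamma> a) + e / 2" by blast
    moreover have "cmod (\<gamma> b - \<gamma> a) < e / 2"
      using d1(2)[OF x(1)] x(2) unfolding a_def b_def
      by (cases "x \<le> c") (simp_all add: dist_norm norm_minus_commute min_absorb1 max_absorb2 min_absorb2 max_absorb1)
    moreover have "dist (arc_length \<gamma> x) (arc_length \<gamma> c) = arc_length \<gamma> b - arc_length \<gamma> a"
      using arc_length_mono[OF ab] unfolding a_def b_def dist_real_def by (cases "x \<le> c") auto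
    ultimately show "dist (arc_length \<gamma> x) (arc_length \<gamma> c) < e" by linarith
  qed (use d1 d2 in auto)
qed

end

section \<open>Riemann--Stieltjes sums\<close>

context rectifiable_curve
begin

text \<open>\<open>\<phi> y\<close> is the increment of the curve over the part of
  \<open>{a..b}\<close> to the left of \<open>y\<close>, so \<open>\<phi> q - \<phi> p\<close> is
  the increment over the intersection of \<open>{p..q}\<close> and \<open>{a..b}\<close>. Two
  divisions can thus be compared cell by cell.\<close>

lemma clamped_increment_bound:
  assumes pq: "0 \<le> p" "p \<le> q" "q \<le> 1" and ab: "0 \<le> a" "a \<le> b" "b \<le> 1"
  defines "\<phi> \<equiv> \<lambda>y. \<gamma> (min y b) - \<gamma> (min y a)"
    and "\<psi> \<equiv> \<lambda>y. arc_length \<gamma> (min y b) - arc_length \<gamma> (min y a)"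
  shows "cmod (\<phi> q - \<phi> p) \<le> \<psi> q - \<psi> p"
    and "{p..q} \<inter> {a..b} = {} \<Longrightarrow> \<phi> q - \<phi> p = 0"
proof -
  consider "q \<le> a" | "b \<le> p" | "a < q" "p < b" by linarith
  then show "cmod (\<phi> q - \<phi> p) \<le> \<psi> q - \<psi> p"
  proof cases
    case 3
    have "\<phi> q - \<phi> p = \<gamma> (min q b) - \<gamma> (max p a)"
      "\<psi> q - \<psi> p = arc_length \<gamma> (min q b) - arc_length \<gamma> (max p a)"
      using 3 pq ab by (auto simp: \<phi>_def \<psi>_def min_def max_def)
    moreover have "0 \<le> max p a" "max p a \<le> min q b" "min q b \<le> 1"
      using 3 pq ab by auto
    ultimately show ?thesis using chord_le_arc_length by simp
  next
    case 2
    then have "min p b = b" "min q b = b" "min p a = a" "min q a = a" using pq ab by auto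
    then show ?thesis by (simp add: \<phi>_def \<psi>_def)
  next
    case 1
    then have "min p b = p" "min q b = q" "min p a = p" "min q a = q" using pq ab by auto
    then show ?thesis by (simp add: \<phi>_def \<psi>_def)
  qed
  show "\<phi> q - \<phi> p = 0" if "{p..q} \<inter> {a..b} = {}"
  proof -
    have "q < a \<or> b < p"
    proof (rule ccontr)
      assume "\<not> ?thesis"
      then have "max p a \<in> {p..q} \<inter> {a..b}" using pq ab by auto
      with that show False by simp
    qed
    then show ?thesis using pq ab by (auto simp: \<phi>_def min_def)
  qed
qed

definition stieltjes_sum :: "(real \<Rightarrow> complex) \<Rightarrow> (real \<times> real set) set \<Rightarrow> complex" where
  "stieltjes_sum h \<D> = (\<Sum>(s, K)\<in>\<D>. h s * (\<gamma> (Sup K) - \<gamma> (Inf K)))"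

lemma tagged_interval:
  assumes "\<D> tagged_division_of {0..1::real}" "(s, K) \<in> \<D>"
  obtains a b where "K = {a..b}" "0 \<le> a" "a \<le> s" "s \<le> b" "b \<le> 1" "Inf K = a" "Sup K = b"
proof -
  obtain a b where K: "K = {a..b}" using tagged_division_ofD(4)[OF assms] by auto
  have "s \<in> K" "K \<subseteq> {0..1}" using tagged_division_ofD(2,3)[OF assms] by auto
  with K that show thesis by auto
qed

text \<open>The sum over the first division is spread out as the increment of a function \<open>J\<close>, so that the
  telescoping lemma replaces the common refinement of the two divisions.\<close>

lemma stieltjes_sum_close:
  assumes D: "\<D> tagged_division_of {0..1::real}" and D': "\<D>' tagged_division_of {0..1::real}"
    and e: "\<And>s K s' K'. (s, K) \<in> \<D> \<Longrightarrow> (s', K') \<in> \<D>' \<Longrightarrow> K \<inter> K' \<noteq> {} \<Longrightarrow> cmod (h s - h s') \<le> e"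
  shows "cmod (stieltjes_sum h \<D>' - stieltjes_sum h \<D>) \<le> e * arc_length \<gamma> 1"
proof -
  \<comment> \<open>The first sum with every cell cut off at \<open>x\<close>: the increment of
    \<open>J\<close> over a cell of the second division collects the pieces of the first that lie in
    it.\<close>
  define J where "J x = (\<Sum>(s, K)\<in>\<D>. h s * (\<gamma> (min (Sup K) x) - \<gamma> (min (Inf K) x)))" for x
  define \<L> where "\<L> = arc_length \<gamma>"
  have J: "J 1 - J 0 = stieltjes_sum h \<D>"
  proof -
    have bounds: "0 \<le> Inf K \<and> 0 \<le> Sup K \<and> Inf K \<le> 1 \<and> Sup K \<le> 1" if sK: "(s, K) \<in> \<D>" for s K
    proof -
      obtain a b where "0 \<le> a" "a \<le> s" "s \<le> b" "b \<le> 1" "Inf K = a" "Sup K = b"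
        using tagged_interval[OF D sK] by metis
      then show ?thesis by simp
    qed
    have "J 0 = 0"
      unfolding J_def using bounds by (intro sum.neutral) (auto simp: min_absorb2)
    moreover have "J 1 = stieltjes_sum h \<D>"
      unfolding J_def stieltjes_sum_def using bounds by (intro sum.cong refl) (auto simp: min_absorb1)
    ultimately show ?thesis by simp
  qed
  have piece: "cmod (h s' * (\<gamma> (Sup K') - \<gamma> (Inf K')) - (J (Sup K') - J (Inf K'))) \<le> e * (\<L> (Sup K') - \<L> (Inf K'))"
    if sK': "(s', K') \<in> \<D>'" for s' K'
  proof -
    obtain a b where K': "K' = {a..b}" "0 \<le> a" "a \<le> s'" "s' \<le> b" "b \<le> 1" "Inf K' = a" "Sup K' = b"
      using tagged_interval[OF D' sK'] by metis
    define \<phi> where "\<phi> y = \<gamma> (min y b) - \<gamma> (min y a)" for y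
    define \<psi> where "\<psi> y = \<L> (min y b) - \<L> (min y a)" for y
    have "(\<Sum>(s, K)\<in>\<D>. \<phi> (Sup K) - \<phi> (Inf K)) = \<phi> 1 - \<phi> 0"
      by (rule additive_tagged_division_1[OF _ D]) simp
    then have sum_\<phi>: "(\<Sum>(s, K)\<in>\<D>. \<phi> (Sup K) - \<phi> (Inf K)) = \<gamma> b - \<gamma> a"
      using K' by (simp add: \<phi>_def)
    have "(\<Sum>(s, K)\<in>\<D>. \<psi> (Sup K) - \<psi> (Inf K)) = \<psi> 1 - \<psi> 0"
      by (rule additive_tagged_division_1[OF _ D]) simp
    then have sum_\<psi>: "(\<Sum>(s, K)\<in>\<D>. \<psi> (Sup K) - \<psi> (Inf K)) = \<L> b - \<L> a"
      using K' by (simp add: \<psi>_def)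
    have JJ: "J b - J a = (\<Sum>(s, K)\<in>\<D>. h s * (\<phi> (Sup K) - \<phi> (Inf K)))"
      unfolding J_def \<phi>_def sum_subtractf[symmetric]
      by (rule sum.cong) (auto simp: algebra_simps)
    have "h s' * (\<gamma> b - \<gamma> a) - (J b - J a)
        = (\<Sum>(s, K)\<in>\<D>. (h s' - h s) * (\<phi> (Sup K) - \<phi> (Inf K)))"
      unfolding JJ sum_\<phi>[symmetric] sum_distrib_left sum_subtractf[symmetric]
      by (rule sum.cong) (auto simp: algebra_simps)
    also have "cmod \<dots> \<le> (\<Sum>(s, K)\<in>\<D>. e * (\<psi> (Sup K) - \<psi> (Inf K)))"
    proof (rule sum_norm_le, clarify)
      fix s K assume sK: "(s, K) \<in> \<D>"
      obtain p q where K: "K = {p..q}" "0 \<le> p" "p \<le> s" "s \<le> q" "q \<le> 1" "Inf K = p" "Sup K = q"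
        using tagged_interval[OF D sK] by metis
      have le: "cmod (\<phi> q - \<phi> p) \<le> \<psi> q - \<psi> p"
        using clamped_increment_bound(1)[of p q a b] K K' by (simp add: \<phi>_def \<psi>_def \<L>_def)
      show "cmod ((h s' - h s) * (\<phi> (Sup K) - \<phi> (Inf K))) \<le> e * (\<psi> (Sup K) - \<psi> (Inf K))"
      proof (cases "K \<inter> K' = {}")
        case True
        have "\<phi> q - \<phi> p = 0"
          using clamped_increment_bound(2)[of p q a b] K K' True by (simp add: \<phi>_def)
        moreover have "\<psi> q - \<psi> p = 0"
        proof -
          have "q < a \<or> b < p"
          proof (rule ccontr)
            assume "\<not> ?thesis"
            then have "max p a \<in> K \<inter> K'" using K K' by auto
            with True show False by simp
          qed
          then show ?thesis using K K' by (auto simp: \<psi>_def min_def)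
        qed
        ultimately show ?thesis unfolding K(6,7) by simp
      next
        case False
        then have "cmod (h s' - h s) \<le> e" using e[OF sK sK'] by (simp add: norm_minus_commute)
        then show ?thesis using le unfolding norm_mult K(6,7)
          by (intro mult_mono) (auto intro: order_trans[OF norm_ge_zero])
      qed
    qed
    also have "\<dots> = e * (\<L> b - \<L> a)"
      unfolding sum_\<psi>[symmetric] sum_distrib_left by (rule sum.cong) auto
    finally show ?thesis using K' by simp
  qed
  have "(\<Sum>(s, K)\<in>\<D>'. J (Sup K) - J (Inf K)) = J 1 - J 0"
    by (rule additive_tagged_division_1[OF _ D']) simp
  then have "stieltjes_sum h \<D>' - stieltjes_sum h \<D>
      = (\<Sum>(s', K')\<in>\<D>'. h s' * (\<gamma> (Sup K') - \<gamma> (Inf K')) - (J (Sup K') - J (Inf K')))"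
    by (simp add: J stieltjes_sum_def[of _ \<D>'] sum_subtractf case_prod_unfold)
  also have "cmod \<dots> \<le> (\<Sum>(s', K')\<in>\<D>'. e * (\<L> (Sup K') - \<L> (Inf K')))"
    using piece by (intro sum_norm_le) auto
  also have "\<dots> = e * (\<Sum>(s', K')\<in>\<D>'. \<L> (Sup K') - \<L> (Inf K'))"
    unfolding sum_distrib_left by (rule sum.cong) auto
  also have "(\<Sum>(s', K')\<in>\<D>'. \<L> (Sup K') - \<L> (Inf K')) = \<L> 1 - \<L> 0"
    by (rule additive_tagged_division_1[OF _ D']) simp
  also have "e * (\<L> 1 - \<L> 0) \<le> e * arc_length \<gamma> 1"
  proof -
    \<comment> \<open>The sign of \<open>e\<close> is not assumed. Both divisions have a cell
      containing 0; these two meet, so the hypothesis on \<open>e\<close> applies to them and forces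
      \<open>0 \<le> e\<close>.\<close>
    obtain s K where "(s, K) \<in> \<D>" "0 \<in> K" using tagged_division_ofD(6)[OF D] by fastforce
    moreover obtain s' K' where "(s', K') \<in> \<D>'" "0 \<in> K'"
      using tagged_division_ofD(6)[OF D'] by fastforce
    ultimately have "cmod (h s - h s') \<le> e" using e by blast
    then have "0 \<le> e" using norm_ge_zero order_trans by blast
    then show ?thesis by (simp add: \<L>_def arc_length_nonneg mult_left_mono)
  qed
  finally show ?thesis .
qed

text \<open>When two \<open>d / 2\<close>-fine cells meet, their tags are less than \<open>d\<close>
  apart, so uniform continuity of \<open>h\<close> supplies the bound needed in
  \<open>stieltjes_sum_close\<close>.\<close>

lemma stieltjes_sum_Cauchy:
  assumes h: "continuous_on {0..1} h" and e: "e > 0"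
  obtains d where "d > 0"
    "\<And>\<D> \<D>'. \<D> tagged_division_of {0..1::real} \<Longrightarrow> \<D>' tagged_division_of {0..1::real} \<Longrightarrow>
       (\<lambda>s. ball s d) fine \<D> \<Longrightarrow> (\<lambda>s. ball s d) fine \<D>' \<Longrightarrow>
       cmod (stieltjes_sum h \<D>' - stieltjes_sum h \<D>) < e"
proof -
  define L where "L = arc_length \<gamma> 1 + 1"
  have L: "L > 0" "arc_length \<gamma> 1 < L" using arc_length_nonneg[of 1] by (auto simp: L_def)
  have "uniformly_continuous_on {0..1} h" using h by (simp add: compact_uniformly_continuous)
  then obtain d where d: "d > 0"
    "\<And>s s'. s \<in> {0..1} \<Longrightarrow> s' \<in> {0..1} \<Longrightarrow> dist s' s < d \<Longrightarrow> dist (h s') (h s) < e / L"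
    unfolding uniformly_continuous_on_def using e L by (metis divide_pos_pos)
  show thesis
  proof (rule that[of "d / 2"])
    fix \<D> \<D>' assume D: "\<D> tagged_division_of {0..1::real}" and D': "\<D>' tagged_division_of {0..1::real}"
      and fine: "(\<lambda>s. ball s (d / 2)) fine \<D>" "(\<lambda>s. ball s (d / 2)) fine \<D>'"
    have "cmod (stieltjes_sum h \<D>' - stieltjes_sum h \<D>) \<le> e / L * arc_length \<gamma> 1"
    proof (rule stieltjes_sum_close[OF D D'])
      fix s K s' K' assume K: "(s, K) \<in> \<D>" "(s', K') \<in> \<D>'" "K \<inter> K' \<noteq> {}"
      then obtain x where x: "x \<in> K" "x \<in> K'" by blast
      then have "x \<in> ball s (d / 2)" "x \<in> ball s' (d / 2)" 
        using subsetD[OF fineD[OF fine(1) K(1)] x(1)] subsetD[OF fineD[OF fine(2) K(2)] x(2)] by auto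
      then have "dist s s' < d" unfolding mem_ball dist_real_def by linarith
      moreover have "s \<in> {0..1}" "s' \<in> {0..1}"
        using tagged_division_ofD(2,3)[OF D K(1)] tagged_division_ofD(2,3)[OF D' K(2)] by auto
      ultimately show "cmod (h s - h s') \<le> e / L"
        using d(2)[of s' s] by (simp add: dist_norm less_imp_le)
    qed
    also have "\<dots> < e" using L e by (simp add: field_simps)
    finally show "cmod (stieltjes_sum h \<D>' - stieltjes_sum h \<D>) < e" .
  qed (use d in simp)
qed

lemma fine_tagged_division_exists:
  assumes "d > 0"
  obtains \<D> where "\<D> tagged_division_of {0..1::real}" "(\<lambda>s. ball s d) fine \<D>"
  using fine_division_exists_real[OF gauge_ball[OF assms], of 0 1] by metis

lemma has_curve_integral_iff:
  "has_curve_integral f I \<gamma> \<longleftrightarrow>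
     (\<forall>e>0. \<exists>d>0. \<forall>\<D>. \<D> tagged_division_of {0..1::real} \<and> (\<lambda>s. ball s d) fine \<D> \<longrightarrow>
        cmod (stieltjes_sum (\<lambda>s. f (\<gamma> s)) \<D> - I) < e)"
  by (simp add: has_curve_integral_def stieltjes_sum_def)

text \<open>Completeness: the sums over ever finer divisions form a Cauchy sequence, and comparison
  with an arbitrary fine division shows that its limit is the integral.\<close>

lemma has_curve_integral_exists:
  assumes f: "continuous_on (path_image \<gamma>) f"
  shows "\<exists>I. has_curve_integral f I \<gamma>"
proof -
  define h where "h = (\<lambda>s. f (\<gamma> s))"
  have h: "continuous_on {0..1} h"
    unfolding h_def using f cont by (intro continuous_on_compose2[OF f cont]) (simp add: path_image_def)
  have "\<exists>\<D>. \<D> tagged_division_of {0..1::real} \<and> (\<lambda>s. ball s (1 / Suc n)) fine \<D>" for n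
    by (rule fine_tagged_division_exists[of "1 / Suc n"]) auto
  then obtain \<D> where \<D>: "\<And>n. \<D> n tagged_division_of {0..1::real}" "\<And>n. (\<lambda>s. ball s (1 / Suc n)) fine \<D> n"
    by metis
  have sub: "(\<lambda>s. ball s d) fine \<D> n" if "1 / Suc n < d" for d n
  proof (rule fineI)
    fix s K assume "(s, K) \<in> \<D> n"
    then have "K \<subseteq> ball s (1 / Suc n)" by (rule fineD[OF \<D>(2)])
    also have "\<dots> \<subseteq> ball s d" using that by (intro subset_ball) simp
    finally show "K \<subseteq> ball s d" .
  qed
  have ev: "\<forall>\<^sub>F n in sequentially. (\<lambda>s. ball s d) fine \<D> n" if "d > 0" for d
  proof -
    have "\<forall>\<^sub>F n in sequentially. 1 / Suc n < d"
      using order_tendstoD(2)[OF LIMSEQ_Suc[OF lim_1_over_n] that] by simp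
    then show ?thesis by eventually_elim (rule sub)
  qed
  have "Cauchy (\<lambda>n. stieltjes_sum h (\<D> n))"
  proof (rule metric_CauchyI)
    fix e :: real assume "e > 0"
    then obtain d where d: "d > 0" "\<And>\<D> \<D>'. \<D> tagged_division_of {0..1::real} \<Longrightarrow> \<D>' tagged_division_of {0..1::real} \<Longrightarrow>
       (\<lambda>s. ball s d) fine \<D> \<Longrightarrow> (\<lambda>s. ball s d) fine \<D>' \<Longrightarrow>
       cmod (stieltjes_sum h \<D>' - stieltjes_sum h \<D>) < e"
      using stieltjes_sum_Cauchy[OF h] by metis
    from ev[OF d(1)] obtain M where M: "\<And>n. n \<ge> M \<Longrightarrow> (\<lambda>s. ball s d) fine \<D> n"
      unfolding eventually_sequentially by blast
    have "dist (stieltjes_sum h (\<D> m)) (stieltjes_sum h (\<D> n)) < e" if "m \<ge> M" "n \<ge> M" for m n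
      unfolding dist_norm by (rule d(2)[OF \<D>(1) \<D>(1) M[OF that(2)] M[OF that(1)]])
    then show "\<exists>M. \<forall>m\<ge>M. \<forall>n\<ge>M. dist (stieltjes_sum h (\<D> m)) (stieltjes_sum h (\<D> n)) < e"
      by blast
  qed
  then obtain I where I: "(\<lambda>n. stieltjes_sum h (\<D> n)) \<longlonglongrightarrow> I"
    using Cauchy_convergent convergent_def by blast
  have "has_curve_integral f I \<gamma>"
    unfolding has_curve_integral_iff h_def[symmetric]
  proof (intro allI impI)
    fix e :: real assume e: "e > 0"
    then obtain d where d: "d > 0" "\<And>\<D> \<D>'. \<D> tagged_division_of {0..1::real} \<Longrightarrow> \<D>' tagged_division_of {0..1::real} \<Longrightarrow>
       (\<lambda>s. ball s d) fine \<D> \<Longrightarrow> (\<lambda>s. ball s d) fine \<D>' \<Longrightarrow>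
       cmod (stieltjes_sum h \<D>' - stieltjes_sum h \<D>) < e / 2"
      using stieltjes_sum_Cauchy[OF h, of "e / 2"] by (metis half_gt_zero)
    have "cmod (stieltjes_sum h \<D>' - I) < e"
      if D': "\<D>' tagged_division_of {0..1::real}" "(\<lambda>s. ball s d) fine \<D>'" for \<D>'
    proof -
      have "cmod (stieltjes_sum h \<D>' - I) \<le> e / 2"
      proof (rule tendsto_upperbound)
        show "(\<lambda>n. cmod (stieltjes_sum h \<D>' - stieltjes_sum h (\<D> n))) \<longlonglongrightarrow> cmod (stieltjes_sum h \<D>' - I)"
          by (intro tendsto_intros I)
        show "\<forall>\<^sub>F n in sequentially. cmod (stieltjes_sum h \<D>' - stieltjes_sum h (\<D> n)) \<le> e / 2"
          using ev[OF d(1)] by eventually_elim (rule less_imp_le[OF d(2)[OF \<D>(1) D'(1) _ D'(2)]])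
      qed simp
      then show ?thesis using e by linarith
    qed
    then show "\<exists>d>0. \<forall>\<D>. \<D> tagged_division_of {0..1::real} \<and> (\<lambda>s. ball s d) fine \<D> \<longrightarrow>
        cmod (stieltjes_sum h \<D> - I) < e" using d(1) by blast
  qed
  then show ?thesis ..
qed

lemma has_curve_integral_unique:
  assumes "has_curve_integral f I \<gamma>" "has_curve_integral f I' \<gamma>"
  shows "I = I'"
proof (rule ccontr)
  assume "I \<noteq> I'"
  then have e: "cmod (I - I') / 2 > 0" by simp
  obtain d where d: "d > 0" "\<And>\<D>. \<D> tagged_division_of {0..1::real} \<Longrightarrow> (\<lambda>s. ball s d) fine \<D> \<Longrightarrow>
        cmod (stieltjes_sum (\<lambda>s. f (\<gamma> s)) \<D> - I) < cmod (I - I') / 2"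
    using assms(1) e unfolding has_curve_integral_iff by metis
  obtain d' where d': "d' > 0" "\<And>\<D>. \<D> tagged_division_of {0..1::real} \<Longrightarrow> (\<lambda>s. ball s d') fine \<D> \<Longrightarrow>
        cmod (stieltjes_sum (\<lambda>s. f (\<gamma> s)) \<D> - I') < cmod (I - I') / 2"
    using assms(2) e unfolding has_curve_integral_iff by metis
  obtain \<D> where \<D>: "\<D> tagged_division_of {0..1::real}" "(\<lambda>s. ball s (min d d')) fine \<D>"
    using fine_tagged_division_exists[of "min d d'"] d(1) d'(1) by auto
  have "(\<lambda>s. ball s d) fine \<D>" "(\<lambda>s. ball s d') fine \<D>"
    using \<D>(2) by (fastforce simp: fine_def)+
  from d(2)[OF \<D>(1) this(1)] d'(2)[OF \<D>(1) this(2)]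
  have "cmod (I - I') < cmod (I - I')"
    unfolding dist_norm[symmetric] by (rule dist_triangle_half_r)
  then show False by simp
qed

lemma has_curve_integral_curve_integral:
  "continuous_on (path_image \<gamma>) f \<Longrightarrow> has_curve_integral f (curve_integral \<gamma> f) \<gamma>"
  unfolding curve_integral_def
  by (rule theI') (use has_curve_integral_exists has_curve_integral_unique in blast)

end

text \<open>Tags at the left end points make the sums take the form
  \<open>f (vertex n i) * edge n i\<close>.\<close>

lemma uniform_tagged_division:
  assumes n: "n > 0"
  shows "(\<lambda>i. (real i / n, {real i / n..real (Suc i) / n})) ` {..<n} tagged_division_of {0..1::real}"
proof (rule tagged_division_ofI)
  fix x K assume "(x, K) \<in> (\<lambda>i. (real i / n, {real i / n..real (Suc i) / n})) ` {..<n}"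
  then obtain i where i: "i < n" "x = real i / n" "K = {real i / n..real (Suc i) / n}" by auto
  then show "x \<in> K" by (simp add: divide_right_mono)
  have "real (Suc i) / n \<le> 1" using i(1) n by simp
  then show "K \<subseteq> {0..1}" using i(3) by (auto intro: order_trans)
  show "\<exists>a b. K = cbox a b" unfolding i(3) by (metis box_real(2))
next
  fix x1 K1 x2 K2 assume K: "(x1, K1) \<in> (\<lambda>i. (real i / n, {real i / n..real (Suc i) / n})) ` {..<n}"
    "(x2, K2) \<in> (\<lambda>i. (real i / n, {real i / n..real (Suc i) / n})) ` {..<n}" "(x1, K1) \<noteq> (x2, K2)"
  then obtain i j where ij: "K1 = {real i / n..real (Suc i) / n}" "K2 = {real j / n..real (Suc j) / n}"
    "i \<noteq> j" by auto
  have "real (Suc i) / n \<le> real j / n \<or> real (Suc j) / n \<le> real i / n"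
    using ij(3) by (cases "i < j") (auto intro!: divide_right_mono)
  then show "interior K1 \<inter> interior K2 = {}" unfolding ij(1,2) by auto
next
  show "\<Union> {K. \<exists>x. (x, K) \<in> (\<lambda>i. (real i / n, {real i / n..real (Suc i) / n})) ` {..<n}} = {0..1}"
    (is "?U = _")
  proof
    show "?U \<subseteq> {0..1}"
    proof
      fix x assume "x \<in> ?U"
      then obtain i where i: "i < n" "real i / n \<le> x" "x \<le> real (Suc i) / n" by auto
      have "real (Suc i) / n \<le> 1" using i(1) n by simp
      moreover have "0 \<le> real i / n" by simp
      ultimately show "x \<in> {0..1}" unfolding atLeastAtMost_iff using i(2,3) by linarith
    qed
    show "{0..1} \<subseteq> ?U"
    proof
      fix x :: real assume x: "x \<in> {0..1}"
      define k where "k = nat \<lfloor>n * x\<rfloor>"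
      have k: "real k \<le> n * x" "n * x < real k + 1"
        using x unfolding k_def by (simp_all add: of_nat_nat)
      \<comment> \<open>For \<open>x = 1\<close> the integer part is \<open>n\<close>, which is not
        the index of a cell; the last cell takes its place.\<close>
      define i where "i = (if k < n then k else n - 1)"
      have "n * x \<le> n" using x n by simp
      have "i < n" using n by (simp add: i_def)
      moreover have "real i \<le> n * x \<and> n * x \<le> real (Suc i)"
      proof (cases "k < n")
        case False
        then have "real n \<le> real k" by simp
        then have "n * x = n" using k(1) \<open>n * x \<le> n\<close> by linarith
        then show ?thesis using False n by (simp add: i_def)
      qed (use k in \<open>simp add: i_def\<close>)
      then have "x \<in> {real i / n..real (Suc i) / n}" using n by (simp add: field_simps)
      ultimately show "x \<in> ?U" by blast
    qed
  qed
qed auto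

section \<open>Inscribed polygons at the uniform partitions\<close>

context rectifiable_curve
begin

definition vertex :: "nat \<Rightarrow> nat \<Rightarrow> complex" where
  "vertex n i = \<gamma> (real i / real n)"

definition edge :: "nat \<Rightarrow> nat \<Rightarrow> complex" where
  "edge n i = vertex n (Suc i) - vertex n i"

lemma uniform_sums_tendsto_curve_integral:
  assumes "continuous_on (path_image \<gamma>) f"
  shows "(\<lambda>n. \<Sum>i<n. f (vertex n i) * edge n i) \<longlonglongrightarrow> curve_integral \<gamma> f"
proof (rule tendstoI)
  fix e :: real assume "e > 0"
  then obtain d where d: "d > 0" "\<And>\<D>. \<D> tagged_division_of {0..1::real} \<Longrightarrow> (\<lambda>s. ball s d) fine \<D> \<Longrightarrow>
      cmod (stieltjes_sum (\<lambda>s. f (\<gamma> s)) \<D> - curve_integral \<gamma> f) < e"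
    using has_curve_integral_curve_integral[OF assms] unfolding has_curve_integral_iff by metis
  have "\<forall>\<^sub>F n in sequentially. 1 / real n < d"
    using order_tendstoD(2)[OF lim_1_over_n d(1)] by simp
  moreover have "\<forall>\<^sub>F n in sequentially. n > (0::nat)" by (rule eventually_gt_at_top)
  ultimately show "\<forall>\<^sub>F n in sequentially. dist (\<Sum>i<n. f (vertex n i) * edge n i) (curve_integral \<gamma> f) < e"
  proof eventually_elim
    case (elim n)
    define U where "U = (\<lambda>i. (real i / n, {real i / n..real (Suc i) / n})) ` {..<n}"
    have "(\<lambda>s. ball s d) fine U"
    proof (rule fineI)
      fix x K assume "(x, K) \<in> U"
      then obtain i where i: "x = real i / n" "K = {real i / n..real (Suc i) / n}" by (auto simp: U_def)
      have "real (Suc i) / n = real i / n + 1 / n" by (simp add: add_divide_distrib)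
      with i elim(1) show "K \<subseteq> ball x d" by (auto simp: dist_real_def)
    qed
    then have "cmod (stieltjes_sum (\<lambda>s. f (\<gamma> s)) U - curve_integral \<gamma> f) < e"
      using d(2) uniform_tagged_division[OF elim(2)] U_def by blast
    moreover have "stieltjes_sum (\<lambda>s. f (\<gamma> s)) U = (\<Sum>i<n. f (vertex n i) * edge n i)"
    proof -
      have "inj_on (\<lambda>i. (real i / n, {real i / n..real (Suc i) / n})) {..<n}"
        using elim(2) by (auto intro!: inj_onI)
      moreover have "real i / n \<le> real (Suc i) / n" for i by (simp add: divide_right_mono)
      ultimately show ?thesis
        unfolding stieltjes_sum_def U_def
        by (subst sum.reindex) (auto simp: edge_def vertex_def intro!: sum.cong)
    qed
    ultimately show ?case by (simp add: dist_norm)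
  qed
qed

end

section \<open>Ahlfors regularity\<close>

lemma integral_inverse_square_atLeast:
  assumes "R > 0"
  shows "(\<integral>\<^sup>+\<eta>\<in>{R..}. ennreal (1 / \<eta>\<^sup>2) \<partial>lborel) = ennreal (1 / R)"
proof -
  have "(\<integral>\<^sup>+\<eta>. ennreal (1 / \<eta>\<^sup>2) * indicator {R..} \<eta> \<partial>lborel) = ennreal (0 - (- 1 / R))"
  proof (rule nn_integral_FTC_atLeast)
    show "((\<lambda>x::real. - 1 / x) \<longlongrightarrow> 0) at_top"
      by (intro tendsto_divide_0[OF tendsto_const] filterlim_at_top_imp_at_infinity filterlim_ident)
    fix x assume "R \<le> x"
    then show "((\<lambda>x. - 1 / x) has_real_derivative 1 / x\<^sup>2) (at x)"
      using assms by (auto intro!: derivative_eq_intros simp: power2_eq_square)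
  qed auto
  then show ?thesis by simp
qed

text \<open>On \<open>{r..2*r}\<close>, an interval of length \<open>r\<close>, the integrand is at
  least \<open>\<omega> r / (2 * r) ^ k\<close>. Used with \<open>k = 3\<close> for weighted sums of
  edges and with \<open>k = 2\<close> for the modulus of continuity itself.\<close>

lemma mono_le_nn_integral:
  fixes \<omega> :: "real \<Rightarrow> real"
  assumes mono: "mono \<omega>" and nonneg: "\<And>\<eta>. 0 \<le> \<omega> \<eta>" and r: "r > 0"
    and k: "k > 0"
  shows "ennreal (\<omega> r / r ^ (k - 1)) \<le> ennreal (2 ^ k) * (\<integral>\<^sup>+\<eta>\<in>{r..2*r}. ennreal (\<omega> \<eta> / \<eta> ^ k) \<partial>lborel)"
proof -
  have "ennreal (2 ^ k) * ennreal (\<omega> r / (2 * r) ^ k * r)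
      = ennreal (2 ^ k) * (\<integral>\<^sup>+\<eta>\<in>{r..2*r}. ennreal (\<omega> r / (2 * r) ^ k) \<partial>lborel)"
    using r nonneg[of r] by (simp add: nn_integral_cmult_indicator ennreal_mult[symmetric])
  also have "\<dots> \<le> ennreal (2 ^ k) * (\<integral>\<^sup>+\<eta>\<in>{r..2*r}. ennreal (\<omega> \<eta> / \<eta> ^ k) \<partial>lborel)"
  proof (intro mult_left_mono nn_integral_mono)
    fix \<eta>
    show "ennreal (\<omega> r / (2 * r) ^ k) * indicator {r..2*r} \<eta> \<le> ennreal (\<omega> \<eta> / \<eta> ^ k) * indicator {r..2*r} \<eta>"
    proof (cases "\<eta> \<in> {r..2*r}")
      case True
      then have "\<eta> ^ k \<le> (2 * r) ^ k" using r by (intro power_mono) auto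
      moreover have "0 < \<eta> ^ k" using True r by (intro zero_less_power) auto
      ultimately have "\<omega> r / (2 * r) ^ k \<le> \<omega> \<eta> / \<eta> ^ k"
        using True nonneg monoD[OF mono, of r \<eta>] by (intro frac_le) auto
      then show ?thesis using True by (simp add: ennreal_leI)
    qed simp
  qed simp
  also have "ennreal (2 ^ k) * ennreal (\<omega> r / (2 * r) ^ k * r) = ennreal (\<omega> r / r ^ (k - 1))"
  proof -
    have "r ^ k = r ^ (k - 1) * r" using k by (cases k) auto
    then have "2 ^ k * (\<omega> r / (2 * r) ^ k * r) = \<omega> r / r ^ (k - 1)"
      using r by (simp add: power_mult_distrib)
    then show ?thesis using r nonneg[of r] by (simp add: ennreal_mult[symmetric])
  qed
  finally show ?thesis .
qed

context rectifiable_curve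
begin

text \<open>The whole arc over each cell is required to be small, not just its edge: this allows
  comparing edges with the measure of nearby arcs, and guarantees that the arc over a cell far from
  a point misses that point.\<close>

definition fine_mesh :: "nat \<Rightarrow> real \<Rightarrow> bool" where
  "fine_mesh n \<eta> \<longleftrightarrow> n > 0 \<and> (\<forall>i<n. \<forall>s\<in>{real i / n..real (Suc i) / n}. cmod (\<gamma> s - vertex n i) < \<eta>)"

lemma eventually_fine_mesh:
  assumes "\<eta> > 0"
  shows "\<forall>\<^sub>F n in sequentially. fine_mesh n \<eta>"
proof -
  have "uniformly_continuous_on {0..1} \<gamma>" using cont by (simp add: compact_uniformly_continuous)
  then obtain d where d: "d > 0"
    "\<And>s s'. s \<in> {0..1} \<Longrightarrow> s' \<in> {0..1} \<Longrightarrow> dist s' s < d \<Longrightarrow> dist (\<gamma> s') (\<gamma> s) < \<eta>"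
    unfolding uniformly_continuous_on_def using assms by metis
  have "\<forall>\<^sub>F n in sequentially. 1 / real n < d"
    using order_tendstoD(2)[OF lim_1_over_n d(1)] by simp
  moreover have "\<forall>\<^sub>F n in sequentially. n > (0::nat)" by (rule eventually_gt_at_top)
  ultimately show ?thesis
  proof eventually_elim
    case (elim n)
    have "cmod (\<gamma> s - vertex n i) < \<eta>" if "i < n" "s \<in> {real i / n..real (Suc i) / n}" for i s
    proof -
      have *: "real (Suc i) / n = real i / n + 1 / n" by (simp add: add_divide_distrib)
      have "real (Suc i) / n \<le> 1" using that(1) by simp
      moreover have "0 \<le> real i / n" "0 \<le> 1 / real n" by simp_all
      ultimately show ?thesis
        using d(2)[of "real i / n" s] that(2) elim(1) *
        unfolding vertex_def dist_norm atLeastAtMost_iff real_norm_def by (smt (verit))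
    qed
    then show ?case unfolding fine_mesh_def using elim(2) by blast
  qed
qed

lemma vertex_on_curve: "n > 0 \<Longrightarrow> i \<le> n \<Longrightarrow> vertex n i \<in> path_image \<gamma>"
  unfolding vertex_def path_image_def by (intro imageI) simp

lemma norm_edge_less: "fine_mesh n \<eta> \<Longrightarrow> i < n \<Longrightarrow> cmod (edge n i) < \<eta>"
  unfolding fine_mesh_def edge_def vertex_def by (force simp: divide_right_mono)

lemma norm_edge_le_arc_length:
  assumes "i < n"
  shows "cmod (edge n i) \<le> arc_length \<gamma> (real (Suc i) / n) - arc_length \<gamma> (real i / n)"
  unfolding edge_def vertex_def using assms by (intro chord_le_arc_length divide_right_mono) auto

lemma sum_edges_le_arc_length: "(\<Sum>i<n. cmod (edge n i)) \<le> arc_length \<gamma> 1"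
proof (cases "n = 0")
  case False
  have "(\<Sum>i<n. cmod (edge n i)) \<le> (\<Sum>i<n. arc_length \<gamma> (real (Suc i) / n) - arc_length \<gamma> (real i / n))"
    by (intro sum_mono norm_edge_le_arc_length) simp
  also have "\<dots> = arc_length \<gamma> (real n / n) - arc_length \<gamma> (real 0 / n)"
    by (rule sum_lessThan_telescope)
  also have "\<dots> \<le> arc_length \<gamma> 1" using False arc_length_nonneg[of 0] by simp
  finally show ?thesis .
qed (simp add: arc_length_nonneg)

text \<open>Compactness makes the parameter set behind \<open>mes\<close> measurable and of finite
  measure.\<close>

lemma compact_arc_length_image:
  "compact (arc_length \<gamma> ` {s \<in> {0..1}. \<gamma> s \<in> curve_nbhd \<gamma> r x})"
proof (rule compact_continuous_image)
  have "{s \<in> {0..1}. \<gamma> s \<in> curve_nbhd \<gamma> r x} = {0..1} \<inter> \<gamma> -` cball x r"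
    by (auto simp: curve_nbhd_def path_image_def dist_norm norm_minus_commute)
  moreover have "closed ({0..1} \<inter> \<gamma> -` cball x r)"
    using cont by (rule continuous_closed_preimage) auto
  ultimately show "compact {s \<in> {0..1}. \<gamma> s \<in> curve_nbhd \<gamma> r x}"
    by (simp add: compact_eq_bounded_closed bounded_Int)
  show "continuous_on {s \<in> {0..1}. \<gamma> s \<in> curve_nbhd \<gamma> r x} (arc_length \<gamma>)"
    by (rule continuous_on_subset[OF continuous_on_arc_length]) auto
qed

lemma mes_curve_nbhd_le: "mes \<gamma> (curve_nbhd \<gamma> r x) \<le> arc_length \<gamma> 1"
proof -
  have "arc_length \<gamma> ` {s \<in> {0..1}. \<gamma> s \<in> curve_nbhd \<gamma> r x} \<subseteq> {0..arc_length \<gamma> 1}"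
    using arc_length_nonneg arc_length_mono by auto
  then have "mes \<gamma> (curve_nbhd \<gamma> r x) \<le> measure lebesgue {0..arc_length \<gamma> 1}"
    unfolding mes_def
    by (rule measure_mono_fmeasurable) (intro fmeasurableD lmeasurable_compact compact_arc_length_image, simp)
  then show ?thesis using arc_length_nonneg[of 1] by simp
qed

text \<open>In the arc-length parameter the cells are disjoint intervals at least as long as their
  edges. Arc length is continuous, so each value in such an interval is attained on the arc over the
  cell, and that arc stays within \<open>r + \<eta>\<close> of \<open>x\<close>.\<close>

lemma sum_edges_le_mes:
  assumes mesh: "fine_mesh n \<eta>"
  shows "(\<Sum>i | i < n \<and> cmod (vertex n i - x) \<le> r. cmod (edge n i)) \<le> mes \<gamma> (curve_nbhd \<gamma> (r + \<eta>) x)"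
proof -
  define I where "I = {i. i < n \<and> cmod (vertex n i - x) \<le> r}"
  have I: "finite I" "\<And>i. i \<in> I \<Longrightarrow> i < n" by (auto simp: I_def)
  have n: "n > 0" using mesh by (simp add: fine_mesh_def)
  define \<L> where "\<L> i = arc_length \<gamma> (real i / n)" for i
  have \<L>_mono: "\<L> i \<le> \<L> j" if "i \<le> j" "j \<le> n" for i j
    unfolding \<L>_def using that n by (intro arc_length_mono) (auto intro: divide_right_mono)
  have \<L>_step: "\<L> i \<le> \<L> (Suc i)" if "i \<in> I" for i
    using I(2)[OF that] by (intro \<L>_mono) (auto simp: Suc_le_eq)
  define T where "T = {s \<in> {0..1}. \<gamma> s \<in> curve_nbhd \<gamma> (r + \<eta>) x}"
  have "(\<Sum>i\<in>I. cmod (edge n i)) \<le> (\<Sum>i\<in>I. \<L> (Suc i) - \<L> i)"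
    unfolding \<L>_def using I by (intro sum_mono norm_edge_le_arc_length) auto
  \<comment> \<open>Half-open intervals, so that adjacent cells are disjoint.\<close>
  also have "\<dots> = (\<Sum>i\<in>I. measure lebesgue {\<L> i<..\<L> (Suc i)})"
  proof (intro sum.cong refl)
    fix i assume "i \<in> I"
    then have "\<L> i \<le> \<L> (Suc i)" by (rule \<L>_step)
    moreover have "measure lebesgue {\<L> i<..\<L> (Suc i)} = measure lborel {\<L> i<..\<L> (Suc i)}"
      by (rule measure_completion) simp
    ultimately show "\<L> (Suc i) - \<L> i = measure lebesgue {\<L> i<..\<L> (Suc i)}"
      by (simp only: measure_lborel_Ioc)
  qed
  also have "\<dots> = measure lebesgue (\<Union>i\<in>I. {\<L> i<..\<L> (Suc i)})"
  proof (rule measure_finite_Union[symmetric])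
    show "disjoint_family_on (\<lambda>i. {\<L> i<..\<L> (Suc i)}) I"
      unfolding disjoint_family_on_def
    proof (intro ballI impI)
      fix i j assume ij: "i \<in> I" "j \<in> I" "i \<noteq> j"
      have "Suc i \<le> j \<or> Suc j \<le> i" using ij(3) by linarith
      then have "\<L> (Suc i) \<le> \<L> j \<or> \<L> (Suc j) \<le> \<L> i"
        using \<L>_mono[of "Suc i" j] \<L>_mono[of "Suc j" i] I(2)[OF ij(1)] I(2)[OF ij(2)] by auto
      then show "{\<L> i<..\<L> (Suc i)} \<inter> {\<L> j<..\<L> (Suc j)} = {}" by auto
    qed
  qed (use I \<L>_step in \<open>auto simp: emeasure_lborel_Ioc\<close>)
  also have "\<dots> \<le> measure lebesgue (arc_length \<gamma> ` T)"
  proof (rule measure_mono_fmeasurable)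
    show "(\<Union>i\<in>I. {\<L> i<..\<L> (Suc i)}) \<subseteq> arc_length \<gamma> ` T"
    proof (rule UN_least)
      fix i assume i: "i \<in> I"
      have le: "real i / n \<le> real (Suc i) / n" by (simp add: divide_right_mono)
      have le1: "real (Suc i) / n \<le> 1" using I(2)[OF i] by simp
      show "{\<L> i<..\<L> (Suc i)} \<subseteq> arc_length \<gamma> ` T"
      proof
        fix y assume y: "y \<in> {\<L> i<..\<L> (Suc i)}"
        have "continuous_on {real i / n..real (Suc i) / n} (arc_length \<gamma>)"
          by (rule continuous_on_subset[OF continuous_on_arc_length]) (use le1 in \<open>auto intro: order_trans\<close>)
        then obtain s where s: "real i / n \<le> s" "s \<le> real (Suc i) / n" "arc_length \<gamma> s = y"
          using IVT'[of "arc_length \<gamma>" "real i / n" y "real (Suc i) / n"] y le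
          unfolding \<L>_def by auto
        have s01: "s \<in> {0..1}"
          using s le1 order_trans[of 0 "real i / n" s] by auto
        have "cmod (\<gamma> s - vertex n i) < \<eta>"
          using mesh I(2)[OF i] s unfolding fine_mesh_def by auto
        moreover have "cmod (vertex n i - x) \<le> r" using i by (simp add: I_def)
        ultimately have "cmod (\<gamma> s - x) \<le> r + \<eta>"
          using norm_triangle_ineq[of "\<gamma> s - vertex n i" "vertex n i - x"] by simp
        then have "s \<in> T" using s01 by (simp add: T_def curve_nbhd_def path_image_def)
        then show "y \<in> arc_length \<gamma> ` T" using s(3) by blast
      qed
    qed
    show "arc_length \<gamma> ` T \<in> lmeasurable"
      unfolding T_def by (intro lmeasurable_compact compact_arc_length_image)
  qed auto
  finally show ?thesis by (simp add: I_def T_def mes_def)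
qed

text \<open>The asymptotic condition controls only radii below some \<open>b\<close>. For larger
  radii the total length is at most \<open>arc_length \<gamma> 1 / b\<close> times the
  radius.\<close>

lemma Ahlfors_regular_bound:
  assumes "Ahlfors_regular \<gamma>"
  obtains C where "C > 0"
    "\<And>x r. x \<in> path_image \<gamma> \<Longrightarrow> r > 0 \<Longrightarrow> mes \<gamma> (curve_nbhd \<gamma> r x) \<le> C * r"
proof -
  obtain c where c: "c > 0" "\<forall>\<^sub>F r in at_right 0.
      norm (SUP x \<in> path_image \<gamma>. mes \<gamma> (curve_nbhd \<gamma> r x)) \<le> c * norm r"
    using assms unfolding Ahlfors_regular_def by (elim landau_o.bigE)
  then obtain b where b: "b > 0" "\<And>r. 0 < r \<Longrightarrow> r < b \<Longrightarrow>
      norm (SUP x \<in> path_image \<gamma>. mes \<gamma> (curve_nbhd \<gamma> r x)) \<le> c * norm r"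
    unfolding eventually_at_right_field by auto
  have sup: "mes \<gamma> (curve_nbhd \<gamma> r x) \<le> (SUP x \<in> path_image \<gamma>. mes \<gamma> (curve_nbhd \<gamma> r x))"
    if "x \<in> path_image \<gamma>" for r x
    using that mes_curve_nbhd_le by (intro cSUP_upper bdd_aboveI2)
  show thesis
  proof (rule that[of "max c (arc_length \<gamma> 1 / b)"])
    fix x r assume x: "x \<in> path_image \<gamma>" and r: "(r::real) > 0"
    show "mes \<gamma> (curve_nbhd \<gamma> r x) \<le> max c (arc_length \<gamma> 1 / b) * r"
    proof (cases "r < b")
      case True
      then have "mes \<gamma> (curve_nbhd \<gamma> r x) \<le> c * r" using b(2)[OF r] sup[OF x, of r] r by simp
      also have "\<dots> \<le> max c (arc_length \<gamma> 1 / b) * r" using r by (intro mult_right_mono) auto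
      finally show ?thesis .
    next
      case False
      have "mes \<gamma> (curve_nbhd \<gamma> r x) \<le> arc_length \<gamma> 1 / b * b"
        using mes_curve_nbhd_le b(1) by simp
      also have "\<dots> \<le> max c (arc_length \<gamma> 1 / b) * r"
        using False b(1) c(1) by (intro mult_mono) (auto simp: arc_length_nonneg)
      finally show ?thesis .
    qed
  qed (use c in simp)
qed

end

locale Ahlfors_curve = rectifiable_curve +
  fixes C :: real
  assumes C_pos: "C > 0"
    and mes_le: "\<And>x r. x \<in> path_image \<gamma> \<Longrightarrow> r > 0 \<Longrightarrow> mes \<gamma> (curve_nbhd \<gamma> r x) \<le> C * r"
begin

text \<open>The factor 2 absorbs the enlargement of the radius from \<open>r\<close> to
  \<open>r + \<eta>\<close>.\<close>

lemma sum_edges_near_le: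
  assumes "fine_mesh n \<eta>" "x \<in> path_image \<gamma>" "0 < \<eta>" "\<eta> \<le> r"
  shows "(\<Sum>i | i < n \<and> cmod (vertex n i - x) \<le> r. cmod (edge n i)) \<le> 2 * C * r"
proof -
  have "(\<Sum>i | i < n \<and> cmod (vertex n i - x) \<le> r. cmod (edge n i)) \<le> C * (r + \<eta>)"
    using assms by (intro order_trans[OF sum_edges_le_mes mes_le]) auto
  also have "\<dots> \<le> C * (r + r)" using assms C_pos by (intro mult_left_mono) auto
  finally show ?thesis by simp
qed

text \<open>A layer-cake argument: \<open>\<omega>(r) / r\<^sup>2\<close> is at most \<open>8\<close> times the integral of \<open>\<omega>(\<eta>) / \<eta>\<^sup>3\<close> over
  \<open>[r, 2r]\<close>, and after exchanging sum and integral regularity bounds the edges contributing at \<open>\<eta>\<close>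
  by \<open>2 C \<eta>\<close>.\<close>

lemma sum_edges_weighted_le:
  fixes \<omega> :: "real \<Rightarrow> real"
  assumes mono: "mono \<omega>" and nonneg: "\<And>\<eta>. 0 \<le> \<omega> \<eta>"
    and mesh: "fine_mesh n R" and x: "x \<in> path_image \<gamma>" and R: "0 < R"
  shows "ennreal (\<Sum>i | i < n \<and> R < cmod (vertex n i - x). \<omega> (cmod (vertex n i - x)) / (cmod (vertex n i - x))\<^sup>2 * cmod (edge n i))
    \<le> ennreal (16 * C) * (\<integral>\<^sup>+\<eta>\<in>{R..2 * diameter (path_image \<gamma>)}. ennreal (\<omega> \<eta> / \<eta>\<^sup>2) \<partial>lborel)"
proof -
  define I where "I = {i. i < n \<and> R < cmod (vertex n i - x)}"
  define r where "r i = cmod (vertex n i - x)" for i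
  define d where "d = diameter (path_image \<gamma>)"
  have I: "finite I" "\<And>i. i \<in> I \<Longrightarrow> i < n" "\<And>i. i \<in> I \<Longrightarrow> R < r i" by (auto simp: I_def r_def)
  have n: "n > 0" using mesh by (simp add: fine_mesh_def)
  have bdd: "bounded (path_image \<gamma>)"
    using simple by (simp add: bounded_simple_path_image)
  have rd: "r i \<le> d" if "i \<in> I" for i
    using diameter_bounded_bound[OF bdd vertex_on_curve[OF n] x, of i] I(2)[OF that]
    by (simp add: r_def d_def dist_norm)
  have [measurable]: "\<omega> \<in> borel_measurable borel" by (rule borel_measurable_mono[OF mono])
  have "ennreal (\<Sum>i\<in>I. \<omega> (r i) / (r i)\<^sup>2 * cmod (edge n i)) = (\<Sum>i\<in>I. ennreal (cmod (edge n i)) * ennreal (\<omega> (r i) / (r i)\<^sup>2))"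
    using nonneg by (subst sum_ennreal[symmetric]) (auto simp: ennreal_mult[symmetric] mult.commute)
  also have "\<dots> \<le> (\<Sum>i\<in>I. ennreal (cmod (edge n i)) * (ennreal 8 * (\<integral>\<^sup>+\<eta>\<in>{r i..2 * r i}. ennreal (\<omega> \<eta> / \<eta> ^ 3) \<partial>lborel)))"
  proof (intro sum_mono mult_left_mono)
    fix i assume "i \<in> I"
    then have "0 < r i" using I(3) R by fastforce
    then show "ennreal (\<omega> (r i) / (r i)\<^sup>2) \<le> ennreal 8 * (\<integral>\<^sup>+\<eta>\<in>{r i..2 * r i}. ennreal (\<omega> \<eta> / \<eta> ^ 3) \<partial>lborel)"
      using mono_le_nn_integral[OF mono nonneg, of "r i" 3] by simp
  qed simp
  also have "\<dots> = (\<Sum>i\<in>I. \<integral>\<^sup>+\<eta>. ennreal (cmod (edge n i)) * (ennreal 8 * (ennreal (\<omega> \<eta> / \<eta> ^ 3) * indicator {r i..2 * r i} \<eta>)) \<partial>lborel)"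
    by (simp add: nn_integral_cmult)
  also have "\<dots> = (\<integral>\<^sup>+\<eta>. (\<Sum>i\<in>I. ennreal (cmod (edge n i)) * (ennreal 8 * (ennreal (\<omega> \<eta> / \<eta> ^ 3) * indicator {r i..2 * r i} \<eta>))) \<partial>lborel)"
    by (rule nn_integral_sum[symmetric]) measurable
  also have "\<dots> \<le> (\<integral>\<^sup>+\<eta>. ennreal (16 * C) * (ennreal (\<omega> \<eta> / \<eta>\<^sup>2) * indicator {R..2 * d} \<eta>) \<partial>lborel)"
  proof (rule nn_integral_mono)
    fix \<eta> :: real
    \<comment> \<open>The edges that contribute at \<open>\<eta>\<close>. They lie within
      \<open>\<eta>\<close> of \<open>x\<close>, so regularity bounds their length, and if there is
      one then \<open>\<eta>\<close> lies in \<open>{R..2 * d}\<close>.\<close>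
    define I' where "I' = {i \<in> I. r i \<le> \<eta> \<and> \<eta> \<le> 2 * r i}"
    have fin: "finite I'" using I(1) by (simp add: I'_def)
    have "(\<Sum>i\<in>I. ennreal (cmod (edge n i)) * (ennreal 8 * (ennreal (\<omega> \<eta> / \<eta> ^ 3) * indicator {r i..2 * r i} \<eta>)))
        = (\<Sum>i\<in>I'. ennreal (cmod (edge n i)) * (ennreal 8 * (ennreal (\<omega> \<eta> / \<eta> ^ 3))))"
      using I(1) unfolding I'_def by (intro sum.mono_neutral_cong_right) auto
    also have "\<dots> \<le> ennreal (16 * C) * (ennreal (\<omega> \<eta> / \<eta>\<^sup>2) * indicator {R..2 * d} \<eta>)"
    proof (cases "I' = {}")
      case False
      then obtain j where j: "j \<in> I" "r j \<le> \<eta>" "\<eta> \<le> 2 * r j" by (auto simp: I'_def)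
      then have \<eta>: "R < \<eta>" "\<eta> \<le> 2 * d" "0 < \<eta>" using I(3)[of j] rd[of j] R by auto
      have "(\<Sum>i\<in>I'. cmod (edge n i)) \<le> (\<Sum>i | i < n \<and> cmod (vertex n i - x) \<le> \<eta>. cmod (edge n i))"
        by (rule sum_mono2) (auto simp: I'_def r_def I_def)
      also have "\<dots> \<le> 2 * C * \<eta>" using sum_edges_near_le[OF mesh x R] \<eta> by simp
      finally have le: "(\<Sum>i\<in>I'. cmod (edge n i)) \<le> 2 * C * \<eta>" .
      have "(\<Sum>i\<in>I'. ennreal (cmod (edge n i)) * (ennreal 8 * ennreal w))
          = ennreal ((\<Sum>i\<in>I'. cmod (edge n i)) * (8 * w))" if "0 \<le> w" for w
        using that by (simp add: sum_distrib_right[symmetric] ennreal_mult sum_nonneg)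
      then have "(\<Sum>i\<in>I'. ennreal (cmod (edge n i)) * (ennreal 8 * (ennreal (\<omega> \<eta> / \<eta> ^ 3))))
          = ennreal ((\<Sum>i\<in>I'. cmod (edge n i)) * (8 * (\<omega> \<eta> / \<eta> ^ 3)))"
        using nonneg \<eta>(3) by simp
      also have "\<dots> \<le> ennreal ((2 * C * \<eta>) * (8 * (\<omega> \<eta> / \<eta> ^ 3)))"
        using nonneg \<eta>(3) by (intro ennreal_leI mult_right_mono le) auto
      also have "(2 * C * \<eta>) * (8 * (\<omega> \<eta> / \<eta> ^ 3)) = 16 * C * (\<omega> \<eta> / \<eta>\<^sup>2)"
        using \<eta>(3) by (simp add: power2_eq_square power3_eq_cube)
      also have "ennreal \<dots> = ennreal (16 * C) * (ennreal (\<omega> \<eta> / \<eta>\<^sup>2) * indicator {R..2 * d} \<eta>)"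
        using \<eta> C_pos nonneg by (simp add: ennreal_mult[symmetric])
      finally show ?thesis .
    qed simp
    finally show "(\<Sum>i\<in>I. ennreal (cmod (edge n i)) * (ennreal 8 * (ennreal (\<omega> \<eta> / \<eta> ^ 3) * indicator {r i..2 * r i} \<eta>)))
        \<le> ennreal (16 * C) * (ennreal (\<omega> \<eta> / \<eta>\<^sup>2) * indicator {R..2 * d} \<eta>)" .
  qed
  also have "\<dots> = ennreal (16 * C) * (\<integral>\<^sup>+\<eta>\<in>{R..2 * d}. ennreal (\<omega> \<eta> / \<eta>\<^sup>2) \<partial>lborel)"
    by (rule nn_integral_cmult) measurable
  finally show ?thesis by (simp add: I_def r_def d_def)
qed

text \<open>The constant weight 1, with the range of integration extended to infinity.\<close>

lemma sum_edges_inverse_square_le: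
  assumes "fine_mesh n R" "x \<in> path_image \<gamma>" "0 < R"
  shows "(\<Sum>i | i < n \<and> R < cmod (vertex n i - x). cmod (edge n i) / (cmod (vertex n i - x))\<^sup>2) \<le> 16 * C / R"
proof -
  have "ennreal (\<Sum>i | i < n \<and> R < cmod (vertex n i - x). cmod (edge n i) / (cmod (vertex n i - x))\<^sup>2)
      \<le> ennreal (16 * C) * (\<integral>\<^sup>+\<eta>\<in>{R..2 * diameter (path_image \<gamma>)}. ennreal (1 / \<eta>\<^sup>2) \<partial>lborel)"
    using sum_edges_weighted_le[of "\<lambda>_. 1", OF _ _ assms] by (simp add: mono_def)
  also have "\<dots> \<le> ennreal (16 * C) * (\<integral>\<^sup>+\<eta>\<in>{R..}. ennreal (1 / \<eta>\<^sup>2) \<partial>lborel)"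
    by (intro mult_left_mono nn_integral_mono) (auto simp: indicator_def)
  also have "\<dots> = ennreal (16 * C / R)"
    using integral_inverse_square_atLeast[OF assms(3)] C_pos assms(3)
    by (simp add: ennreal_mult[symmetric])
  finally show ?thesis using C_pos assms(3) by simp
qed

end

section \<open>Variation of the argument\<close>

text \<open>Any values of the argument will do, since the sine does not see multiples of \<open>2\<pi>\<close>: the
  continuity of the branch is never used.\<close>

lemma Im_quotient_le_arg_diff:
  assumes "is_Arg w1 a1" "is_Arg w2 a2"
  shows "\<bar>Im (w2 / w1)\<bar> \<le> cmod w2 / cmod w1 * \<bar>a2 - a1\<bar>"
proof -
  have "w2 / w1 = of_real (cmod w2) * exp (\<i> * of_real a2) / (of_real (cmod w1) * exp (\<i> * of_real a1))"
    using assms by (simp add: is_Arg_def)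
  also have "\<dots> = of_real (cmod w2 / cmod w1) * exp (\<i> * of_real (a2 - a1))"
    by (simp add: exp_diff right_diff_distrib)
  finally have "Im (w2 / w1) = cmod w2 / cmod w1 * sin (a2 - a1)"
    by (simp add: Im_exp)
  then show ?thesis
    by (simp add: abs_mult mult_left_mono abs_sin_x_le_abs_x del: times_divide_eq_left)
qed

lemma is_Arg_limit:
  assumes lim: "(A \<longlongrightarrow> a) F" and F: "F \<noteq> bot" and ev: "\<forall>\<^sub>F \<delta> in F. is_Arg w (A \<delta>)"
  shows "is_Arg w a"
proof -
  have "((\<lambda>\<delta>. of_real (cmod w) * exp (\<i> * of_real (A \<delta>))) \<longlongrightarrow> of_real (cmod w) * exp (\<i> * of_real a)) F"
    by (intro tendsto_intros lim)
  moreover have "((\<lambda>\<delta>. of_real (cmod w) * exp (\<i> * of_real (A \<delta>))) \<longlongrightarrow> w) F"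
    by (rule tendsto_eventually) (use ev in \<open>eventually_elim, simp add: is_Arg_def\<close>)
  ultimately show ?thesis
    using tendsto_unique[OF F] unfolding is_Arg_def by metis
qed

context rectifiable_curve
begin

text \<open>For small \<open>\<delta>\<close> the point \<open>t\<close> is off the cut, because the
  arc in the cut stays within \<open>\<delta>\<close> of \<open>\<xi>\<close> and \<open>h\<close>
  runs in the exterior after its starting point. So \<open>A \<delta> t\<close> is an argument, and
  the limit is one too.\<close>

lemma arg_branch_is_Arg:
  assumes \<xi>: "\<xi> \<in> path_image \<gamma>" and a: "arg_branch \<gamma> \<xi> a" and t: "t \<in> path_image \<gamma>" "t \<noteq> \<xi>"
  shows "is_Arg (t - \<xi>) (a t)"
proof -
  obtain z0 \<phi>0 A where
    A: "\<And>\<delta>. 0 < \<delta> \<Longrightarrow> \<delta> < diameter (path_image \<gamma>) / 2 \<Longrightarrow> arg_delta_branch \<gamma> \<xi> z0 \<phi>0 \<delta> (A \<delta>)"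
    and lim: "\<And>t. t \<in> path_image \<gamma> - {\<xi>} \<Longrightarrow> ((\<lambda>\<delta>. A \<delta> t) \<longlongrightarrow> a t) (at_right 0)"
    using a unfolding arg_branch_def by blast
  have bdd: "bounded (path_image \<gamma>)" using simple by (simp add: bounded_simple_path_image)
  \<comment> \<open>Half the distance is at most half the diameter, so every positive
    \<open>\<delta> < b\<close> is admissible in \<open>arg_branch\<close>.\<close>
  define b where "b = cmod (t - \<xi>) / 2"
  have b: "b > 0" using t by (simp add: b_def)
  have bd: "b \<le> diameter (path_image \<gamma>) / 2"
    using diameter_bounded_bound[OF bdd t(1) \<xi>] by (simp add: b_def dist_norm)
  have "is_Arg (t - \<xi>) (A \<delta> t)" if \<delta>: "0 < \<delta>" "\<delta> < b" for \<delta>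
  proof -
    obtain Cut where C: "argument_cut \<gamma> \<xi> \<delta> Cut" "\<forall>z \<in> - Cut. is_Arg (z - \<xi>) (A \<delta> z)"
      using A[of \<delta>] \<delta> bd unfolding arg_delta_branch_def by auto
    obtain u h where uh: "curve_from \<gamma> \<xi> ` {0..u} \<subseteq> connected_component_set (curve_nbhd \<gamma> \<delta> \<xi>) \<xi>"
      "0 \<le> u" "smooth_curve_to_infinity (curve_from \<gamma> \<xi> u) (outside (path_image \<gamma>)) h"
      "Cut = curve_from \<gamma> \<xi> ` {0..u} \<union> h ` {0..}"
      using C(1) unfolding argument_cut_def by blast
    have near: "curve_from \<gamma> \<xi> ` {0..u} \<subseteq> curve_nbhd \<gamma> \<delta> \<xi>"
      using uh(1) connected_component_subset by blast
    have "t \<notin> curve_nbhd \<gamma> \<delta> \<xi>" using \<delta> by (simp add: curve_nbhd_def b_def)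
    moreover have "h s \<in> curve_nbhd \<gamma> \<delta> \<xi> \<or> h s \<notin> path_image \<gamma>" if "s \<ge> 0" for s
    proof (cases "s = 0")
      case True
      then have "h s = curve_from \<gamma> \<xi> u" using uh(3) by (simp add: smooth_curve_to_infinity_def)
      moreover have "u \<in> {0..u}" using uh(2) by simp
      ultimately show ?thesis using near by blast
    next
      case False
      then have "h s \<in> outside (path_image \<gamma>)"
        using uh(3) that by (simp add: smooth_curve_to_infinity_def)
      then show ?thesis by (simp add: outside_def)
    qed
    ultimately have "t \<notin> Cut" unfolding uh(4) using near t(1) by fastforce
    then show ?thesis using C(2) by simp
  qed
  then have "\<forall>\<^sub>F \<delta> in at_right 0. is_Arg (t - \<xi>) (A \<delta> t)"
    unfolding eventually_at_right_field using b by blast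
  with lim t show ?thesis by (intro is_Arg_limit[of "\<lambda>\<delta>. A \<delta> t"]) auto
qed

text \<open>A cell far from \<open>\<xi>\<close> does not contain the parameter \<open>s0\<close> of
  \<open>\<xi>\<close>, so it lies after or before it. Seen from \<open>curve_from\<close>, each
  group consists of cells inside \<open>{0<..<1}\<close> and contributes at most \<open>V\<close>;
  hence the factor 2.\<close>

lemma sum_arg_diff_le:
  assumes mesh: "fine_mesh n \<eta>" and \<xi>: "\<xi> \<in> path_image \<gamma>" and \<eta>: "\<eta> \<le> R"
    and V: "punctured_variation \<gamma> \<xi> a \<le> ennreal V" "0 \<le> V"
  shows "(\<Sum>i | i < n \<and> R < cmod (vertex n i - \<xi>). \<bar>a (vertex n (Suc i)) - a (vertex n i)\<bar>) \<le> 2 * V"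
proof -
  define I where "I = {i. i < n \<and> R < cmod (vertex n i - \<xi>)}"
  define s0 where "s0 = inv_into {0..1} \<gamma> \<xi>"
  define I1 where "I1 = {i \<in> I. s0 < real i / n}"
  define I2 where "I2 = {i \<in> I. real (Suc i) / n < s0}"
  define D where "D i = \<bar>a (vertex n (Suc i)) - a (vertex n i)\<bar>" for i
  have n: "n > 0" using mesh by (simp add: fine_mesh_def)
  have s0: "s0 \<in> {0..1}" "\<gamma> s0 = \<xi>"
    using \<xi> unfolding s0_def path_image_def by (rule inv_into_into, rule f_inv_into_f)
  have far: "cmod (\<gamma> s - vertex n i) < cmod (vertex n i - \<xi>)"
    if "i \<in> I" "s \<in> {real i / n..real (Suc i) / n}" for i s
    using mesh that \<eta> unfolding fine_mesh_def I_def by force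
  have off: "\<gamma> s \<noteq> \<xi>" if "i \<in> I" "s \<in> {real i / n..real (Suc i) / n}" for i s
    using far[OF that] by (auto simp: norm_minus_commute)
  have le: "real i / n \<le> real (Suc i) / n" for i by (simp add: divide_right_mono)
  have le1: "real (Suc i) / n \<le> 1" if "i \<in> I" for i using that by (simp add: I_def)
  have closed: "\<gamma> 0 = \<gamma> 1" using closed_curve by (simp add: pathstart_def pathfinish_def)
  have cf: "curve_from \<gamma> \<xi> s = (if s0 + s \<le> 1 then \<gamma> (s0 + s) else \<gamma> (s0 + s - 1))" for s
    by (simp add: curve_from_def s0_def shiftpath_def)
  have mono: "mono (\<lambda>i. real i / n + c)" for c
    by (auto simp: mono_def divide_right_mono)
  have cover: "I \<subseteq> I1 \<union> I2"
  proof
    fix i assume i: "i \<in> I"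
    then have "s0 \<notin> {real i / n..real (Suc i) / n}" using off s0(2) by blast
    then show "i \<in> I1 \<union> I2" using i by (auto simp: I1_def I2_def)
  qed
  have 1: "sum D I1 \<le> V"
  proof -
    define f where "f s = a (curve_from \<gamma> \<xi> s)" for s
    define p where "p i = real i / n + (- s0)" for i
    have "ennreal (\<Sum>i\<in>I1 \<inter> {..<n}. dist (f (p i)) (f (p (Suc i)))) \<le> punctured_variation \<gamma> \<xi> a"
      unfolding punctured_variation_def f_def[symmetric]
    proof (rule partition_variation_le)
      show "mono p" unfolding p_def by (rule mono)
      fix i assume i: "i \<in> I1"
      then have iI: "i \<in> I" "s0 < real i / n" by (auto simp: I1_def)
      \<comment> \<open>Equality would mean \<open>s0 = 0\<close> and a last cell ending at
        \<open>\<gamma> 1 = \<gamma> 0 = \<xi>\<close>, which is impossible for a far cell.\<close>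
      have "real (Suc i) / n - s0 \<noteq> 1"
      proof
        assume *: "real (Suc i) / n - s0 = 1"
        then have "s0 = 0" "real (Suc i) / n = 1" using le1[OF iI(1)] s0(1) unfolding atLeastAtMost_iff by linarith+
        then have "\<gamma> (real (Suc i) / n) = \<xi>" using s0(2) closed by simp
        then show False using off[OF iI(1)] le by simp
      qed
      then show "p i \<in> {0<..<1} \<and> p (Suc i) \<in> {0<..<1}"
        using iI(2) le[of i] le1[OF iI(1)] s0(1) unfolding p_def by auto
    qed
    also have "(\<Sum>i\<in>I1 \<inter> {..<n}. dist (f (p i)) (f (p (Suc i)))) = sum D I1"
    proof (rule sum.cong)
      show "I1 \<inter> {..<n} = I1" by (auto simp: I1_def I_def)
      fix i assume "i \<in> I1"
      then have "real (Suc i) / n \<le> 1" using le1 by (simp add: I1_def)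
      then have "f (p i) = a (vertex n i)" "f (p (Suc i)) = a (vertex n (Suc i))"
        using le[of i] unfolding f_def p_def cf vertex_def by auto
      then show "dist (f (p i)) (f (p (Suc i))) = D i" by (simp add: D_def dist_real_def abs_minus_commute)
    qed
    finally show ?thesis using V by (metis ennreal_le_iff order_trans)
  qed
  have 2: "sum D I2 \<le> V"
  proof -
    define f where "f s = a (curve_from \<gamma> \<xi> s)" for s
    \<comment> \<open>Points before \<open>s0\<close> are met after the passage through
      \<open>\<gamma> 1 = \<gamma> 0\<close>, which \<open>curve_from\<close> reaches at
      \<open>1 - s0\<close>.\<close>
    define p where "p i = real i / n + (1 - s0)" for i
    have "ennreal (\<Sum>i\<in>I2 \<inter> {..<n}. dist (f (p i)) (f (p (Suc i)))) \<le> punctured_variation \<gamma> \<xi> a"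
      unfolding punctured_variation_def f_def[symmetric]
    proof (rule partition_variation_le)
      show "mono p" unfolding p_def by (rule mono)
      fix i assume i: "i \<in> I2"
      then have iI: "i \<in> I" "real (Suc i) / n < s0" by (auto simp: I2_def)
      have "real i / n + (1 - s0) \<noteq> 0"
      proof
        assume *: "real i / n + (1 - s0) = 0"
        moreover have "0 \<le> real i / n" by simp
        ultimately have "s0 = 1" "real i / n = 0" using s0(1) unfolding atLeastAtMost_iff by linarith+
        then have "\<gamma> (real i / n) = \<xi>" using s0(2) closed by (simp only:)
        then show False using off[OF iI(1)] le by simp
      qed
      moreover have "0 \<le> real i / n" by simp
      ultimately show "p i \<in> {0<..<1} \<and> p (Suc i) \<in> {0<..<1}"
        using iI(2) le[of i] s0(1) unfolding p_def greaterThanLessThan_iff atLeastAtMost_iff by linarith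
    qed
    also have "(\<Sum>i\<in>I2 \<inter> {..<n}. dist (f (p i)) (f (p (Suc i)))) = sum D I2"
    proof (rule sum.cong)
      show "I2 \<inter> {..<n} = I2" by (auto simp: I2_def I_def)
      \<comment> \<open>At \<open>i = 0\<close> the shifted path takes the value
        \<open>\<gamma> 1\<close>, which equals \<open>vertex n 0\<close> because the curve is
        closed.\<close>
      have "f (p i) = a (vertex n i)" for i
        using closed n unfolding f_def p_def cf vertex_def by (cases "i = 0") (auto simp: divide_le_0_iff)
      then show "dist (f (p i)) (f (p (Suc i))) = D i" for i
        by (simp add: D_def dist_real_def abs_minus_commute)
    qed
    finally show ?thesis using V by (metis ennreal_le_iff order_trans)
  qed
  have "sum D I \<le> sum D (I1 \<union> I2)"
    by (rule sum_mono2) (use cover in \<open>auto simp: I1_def I2_def I_def D_def\<close>)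
  also have "\<dots> \<le> sum D I1 + sum D I2"
    by (subst sum_Un) (auto simp: I1_def I2_def I_def D_def intro!: sum_nonneg)
  finally show ?thesis using 1 2 by (simp add: I_def D_def)
qed

end

locale Kral_Ahlfors_curve = Ahlfors_curve +
  fixes V :: real
  assumes V_nonneg: "V \<ge> 0"
    and arg_variation: "\<And>\<xi>. \<xi> \<in> path_image \<gamma> \<Longrightarrow> \<exists>a. arg_branch \<gamma> \<xi> a \<and> punctured_variation \<gamma> \<xi> a \<le> ennreal V"
begin

text \<open>With \<open>w1\<close>, \<open>w2\<close> the ends of the edge seen from
  \<open>\<xi>\<close>, \<open>w2 / w1\<close> exceeds the quotient in question by 1, so the
  imaginary parts agree. A far edge is shorter than \<open>cmod w1\<close>; hence both ends differ
  from \<open>\<xi>\<close>, the ratio of moduli is at most 2, and the bound is twice that of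
  \<open>sum_arg_diff_le\<close>.\<close>

lemma sum_Im_far_le:
  assumes mesh: "fine_mesh n \<eta>" and \<xi>: "\<xi> \<in> path_image \<gamma>" and \<eta>: "0 < \<eta>" "\<eta> \<le> R"
  shows "(\<Sum>i | i < n \<and> R < cmod (vertex n i - \<xi>). \<bar>Im (edge n i / (vertex n i - \<xi>))\<bar>) \<le> 4 * V"
proof -
  obtain a where a: "arg_branch \<gamma> \<xi> a" "punctured_variation \<gamma> \<xi> a \<le> ennreal V"
    using arg_variation[OF \<xi>] by blast
  have n: "n > 0" using mesh by (simp add: fine_mesh_def)
  have "(\<Sum>i | i < n \<and> R < cmod (vertex n i - \<xi>). \<bar>Im (edge n i / (vertex n i - \<xi>))\<bar>)
     \<le> (\<Sum>i | i < n \<and> R < cmod (vertex n i - \<xi>). 2 * \<bar>a (vertex n (Suc i)) - a (vertex n i)\<bar>)"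
  proof (rule sum_mono, clarify)
    fix i assume i: "i < n" "R < cmod (vertex n i - \<xi>)"
    define w1 where "w1 = vertex n i - \<xi>"
    define w2 where "w2 = vertex n (Suc i) - \<xi>"
    have e: "cmod (w2 - w1) < R"
      using norm_edge_less[OF mesh i(1)] \<eta> by (simp add: w1_def w2_def edge_def)
    have w1: "R < cmod w1" using i(2) by (simp add: w1_def)
    then have "w1 \<noteq> 0" using \<eta> by auto
    have "w2 \<noteq> 0" using e w1 by auto
    have "is_Arg w1 (a (vertex n i))" "is_Arg w2 (a (vertex n (Suc i)))"
      unfolding w1_def w2_def
      using \<open>w1 \<noteq> 0\<close> \<open>w2 \<noteq> 0\<close> i n
      by (auto intro!: arg_branch_is_Arg[OF \<xi> a(1)] vertex_on_curve simp: w1_def w2_def)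
    note Im_quotient_le_arg_diff[OF this]
    also have "cmod w2 / cmod w1 * \<bar>a (vertex n (Suc i)) - a (vertex n i)\<bar> \<le> 2 * \<bar>a (vertex n (Suc i)) - a (vertex n i)\<bar>"
    proof (rule mult_right_mono)
      have "cmod w2 \<le> cmod w1 + cmod (w2 - w1)" using norm_triangle_ineq[of w1 "w2 - w1"] by simp
      then show "cmod w2 / cmod w1 \<le> 2" using e w1 \<open>w1 \<noteq> 0\<close> by (simp add: divide_le_eq)
    qed simp
    also have "Im (w2 / w1) = Im (edge n i / (vertex n i - \<xi>))"
    proof -
      have "w2 / w1 = 1 + edge n i / (vertex n i - \<xi>)"
        using \<open>w1 \<noteq> 0\<close> unfolding w1_def w2_def edge_def by (simp add: field_simps)
      then show ?thesis by simp
    qed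
    finally show "\<bar>Im (edge n i / (vertex n i - \<xi>))\<bar> \<le> 2 * \<bar>a (vertex n (Suc i)) - a (vertex n i)\<bar>" .
  qed
  also have "\<dots> \<le> 2 * (2 * V)"
    unfolding sum_distrib_left[symmetric]
    using sum_arg_diff_le[OF mesh \<xi> \<eta>(2) a(2) V_nonneg] by simp
  finally show ?thesis by simp
qed

text \<open>Compare \<open>z\<close> with its nearest point \<open>x\<close> on the curve, at distance \<open>\<rho>\<close>: within \<open>4\<rho>\<close> of \<open>x\<close> the
  kernel is at most \<open>1 / \<rho>\<close> and the curve has length \<open>O(\<rho>)\<close>; beyond, the kernels of \<open>z\<close> and \<open>x\<close>
  differ by \<open>O(\<rho> / r\<^sup>2)\<close>.\<close>

lemma eventually_sum_Im_le:
  assumes z: "z \<notin> path_image \<gamma>"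
  shows "\<forall>\<^sub>F n in sequentially. (\<Sum>i<n. \<bar>Im (edge n i / (vertex n i - z))\<bar>) \<le> 16 * C + 4 * V"
proof -
  have "closed (path_image \<gamma>)" using simple by (simp add: closed_simple_path_image)
  moreover have "path_image \<gamma> \<noteq> {}" by simp
  ultimately obtain x where x: "x \<in> path_image \<gamma>" "\<And>t. t \<in> path_image \<gamma> \<Longrightarrow> dist z x \<le> dist z t"
    using distance_attains_inf by blast
  define \<rho> where "\<rho> = cmod (z - x)"
  have \<rho>: "\<rho> > 0" using x z by (auto simp: \<rho>_def)
  have dist_z: "\<rho> \<le> cmod (t - z)" if "t \<in> path_image \<gamma>" for t
    using x(2)[OF that] by (simp add: \<rho>_def dist_norm norm_minus_commute)
  have "\<forall>\<^sub>F n in sequentially. fine_mesh n \<rho>" by (rule eventually_fine_mesh[OF \<rho>])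
  then show ?thesis
  proof eventually_elim
    case mesh: (elim n)
    have n: "n > 0" using mesh by (simp add: fine_mesh_def)
    define N where "N = {i. i < n \<and> cmod (vertex n i - x) \<le> 4 * \<rho>}"
    define M where "M = {i. i < n \<and> 4 * \<rho> < cmod (vertex n i - x)}"
    define T where "T i = \<bar>Im (edge n i / (vertex n i - z))\<bar>" for i
    have NM: "{..<n} = N \<union> M" "N \<inter> M = {}" "finite N" "finite M" by (auto simp: N_def M_def)
    have T_le: "T i \<le> cmod (edge n i) / cmod (vertex n i - z)" for i
      unfolding T_def using abs_Im_le_cmod[of "edge n i / (vertex n i - z)"] by (simp add: norm_divide)
    have "sum T N \<le> (\<Sum>i\<in>N. cmod (edge n i) / \<rho>)"
    proof (rule sum_mono)
      fix i assume "i \<in> N"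
      then have "\<rho> \<le> cmod (vertex n i - z)" using dist_z vertex_on_curve[OF n] by (auto simp: N_def)
      then have "cmod (edge n i) / cmod (vertex n i - z) \<le> cmod (edge n i) / \<rho>"
        using \<rho> by (intro divide_left_mono mult_pos_pos) auto
      with T_le[of i] show "T i \<le> cmod (edge n i) / \<rho>" by linarith
    qed
    also have "\<dots> \<le> (2 * C * (4 * \<rho>)) / \<rho>"
      unfolding sum_divide_distrib[symmetric] N_def
      using \<rho> by (intro divide_right_mono sum_edges_near_le[OF mesh x(1)]) auto
    finally have near: "sum T N \<le> 8 * C" using \<rho> by simp
    have "sum T M \<le> (\<Sum>i\<in>M. \<bar>Im (edge n i / (vertex n i - x))\<bar> + 2 * \<rho> * (cmod (edge n i) / (cmod (vertex n i - x))\<^sup>2))"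
    proof (rule sum_mono)
      fix i assume "i \<in> M"
      then have i: "i < n" "4 * \<rho> < cmod (vertex n i - x)" by (auto simp: M_def)
      define r where "r = cmod (vertex n i - x)"
      define t where "t = vertex n i"
      have "r \<le> cmod (t - z) + \<rho>"
        using norm_triangle_ineq[of "t - z" "z - x"] by (simp add: r_def t_def \<rho>_def)
      then have r2: "r / 2 \<le> cmod (t - z)" "r > 0" using i(2) \<rho> by (auto simp: r_def)
      have "t \<noteq> z" "t \<noteq> x" using r2 by (auto simp: r_def t_def)
      then have eq: "edge n i / (t - z) = edge n i / (t - x) + edge n i * (z - x) / ((t - z) * (t - x))"
        by (simp add: divide_simps) (simp add: algebra_simps)
      have "cmod (edge n i * (z - x) / ((t - z) * (t - x))) = cmod (edge n i) * \<rho> / (cmod (t - z) * r)"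
        by (simp add: norm_mult norm_divide \<rho>_def r_def t_def)
      also have "\<dots> \<le> cmod (edge n i) * \<rho> / (r / 2 * r)"
        using r2 \<rho> by (intro divide_left_mono mult_right_mono mult_pos_pos) auto
      also have "\<dots> = 2 * \<rho> * (cmod (edge n i) / r\<^sup>2)" by (simp add: power2_eq_square)
      finally have "cmod (edge n i * (z - x) / ((t - z) * (t - x))) \<le> 2 * \<rho> * (cmod (edge n i) / r\<^sup>2)" .
      then have "\<bar>Im (edge n i * (z - x) / ((t - z) * (t - x)))\<bar> \<le> 2 * \<rho> * (cmod (edge n i) / r\<^sup>2)"
        using abs_Im_le_cmod order_trans by blast
      moreover have "T i \<le> \<bar>Im (edge n i / (t - x))\<bar> + \<bar>Im (edge n i * (z - x) / ((t - z) * (t - x)))\<bar>"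
        unfolding T_def t_def[symmetric] eq plus_complex.sel by (rule abs_triangle_ineq)
      ultimately show "T i \<le> \<bar>Im (edge n i / (vertex n i - x))\<bar> + 2 * \<rho> * (cmod (edge n i) / (cmod (vertex n i - x))\<^sup>2)"
        by (simp add: t_def r_def)
    qed
    also have "\<dots> = (\<Sum>i\<in>M. \<bar>Im (edge n i / (vertex n i - x))\<bar>) + 2 * \<rho> * (\<Sum>i\<in>M. cmod (edge n i) / (cmod (vertex n i - x))\<^sup>2)"
      by (simp add: sum.distrib sum_distrib_left)
    \<comment> \<open>Here \<open>\<rho>\<close> cancels, as it did in the near part, so the final
      bound does not depend on the distance of \<open>z\<close> to the curve.\<close>
    also have "\<dots> \<le> 4 * V + 2 * \<rho> * (16 * C / (4 * \<rho>))"
    proof (intro add_mono mult_left_mono)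
      show "(\<Sum>i\<in>M. \<bar>Im (edge n i / (vertex n i - x))\<bar>) \<le> 4 * V"
        unfolding M_def by (rule sum_Im_far_le[OF mesh x(1)]) (use \<rho> in auto)
      have "fine_mesh n (4 * \<rho>)" using mesh \<rho> unfolding fine_mesh_def by fastforce
      then show "(\<Sum>i\<in>M. cmod (edge n i) / (cmod (vertex n i - x))\<^sup>2) \<le> 16 * C / (4 * \<rho>)"
        unfolding M_def by (rule sum_edges_inverse_square_le[OF _ x(1)]) (use \<rho> in simp)
    qed (use \<rho> in simp)
    finally have far: "sum T M \<le> 4 * V + 8 * C" using \<rho> by simp
    have "sum T {..<n} = sum T N + sum T M"
      unfolding NM(1) by (rule sum.union_disjoint) (use NM in auto)
    then show ?case using near far by (simp add: T_def)
  qed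
qed

end

section \<open>Winding number and Cauchy-type integral\<close>

lemma norm_exp_minus_one_minus_le:
  fixes w :: complex
  assumes "cmod w \<le> 1 / 4"
  shows "cmod (exp w - 1 - w) \<le> 2 * (cmod w)\<^sup>2"
proof -
  have "cmod (exp w - (\<Sum>k\<le>1. w ^ k / fact k)) \<le> exp \<bar>Re w\<bar> * cmod w ^ Suc 1 / fact 1"
    by (rule Taylor_exp)
  then have "cmod (exp w - 1 - w) \<le> exp \<bar>Re w\<bar> * (cmod w)\<^sup>2"
    by (simp add: power2_eq_square diff_diff_eq)
  also have "\<dots> \<le> 2 * (cmod w)\<^sup>2"
  proof (rule mult_right_mono)
    have "exp \<bar>Re w\<bar> \<le> 1 + 2 * \<bar>Re w\<bar>"
      using assms abs_Re_le_cmod[of w] by (intro real_exp_bound_lemma) auto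
    then show "exp \<bar>Re w\<bar> \<le> 2" using assms abs_Re_le_cmod[of w] by simp
  qed simp
  finally show ?thesis .
qed

context rectifiable_curve
begin

text \<open>For a continuous logarithm \<open>q\<close> of \<open>\<gamma> - z\<close> with
  increments \<open>\<delta> i\<close>, each summand is \<open>exp (\<delta> i) - 1\<close>, and the
  \<open>\<delta> i\<close> telescope to the stated limit. The error is quadratic in
  \<open>\<delta> i\<close>: one factor is small by uniform continuity, the other is at most a
  multiple of the edge, so the errors sum to a small multiple of the length.\<close>

lemma uniform_sums_tendsto_winding_number:
  assumes z: "z \<notin> path_image \<gamma>"
  shows "(\<lambda>n. \<Sum>i<n. edge n i / (vertex n i - z)) \<longlonglongrightarrow> 2 * of_real pi * \<i> * winding_number \<gamma> z"
proof -
  have p: "path \<gamma>" using simple by (simp add: simple_path_imp_path)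
  obtain q where q: "path q" "pathfinish q - pathstart q = 2 * of_real pi * \<i> * winding_number \<gamma> z"
    and exp_q: "\<And>t. t \<in> {0..1} \<Longrightarrow> \<gamma> t = z + exp (q t)"
    using winding_number_as_continuous_log[OF p z] by metis
  have "closed (path_image \<gamma>)" using simple by (simp add: closed_simple_path_image)
  then obtain \<rho> where \<rho>: "\<rho> > 0" "\<And>t. t \<in> path_image \<gamma> \<Longrightarrow> \<rho> \<le> dist z t"
    using separate_point_closed z by metis
  define L where "L = arc_length \<gamma> 1"
  have uc: "uniformly_continuous_on {0..1} q"
    using q(1) by (simp add: path_def compact_uniformly_continuous)
  show ?thesis
  proof (rule tendstoI)
    fix e :: real assume e: "e > 0"
    \<comment> \<open>The bound 1/4 admits the estimate of the exponential; the other makes the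
      total error \<open>4 * \<tau> / \<rho> * L\<close> smaller than \<open>e\<close>.\<close>
    define \<tau> where "\<tau> = min (1/4) (e * \<rho> / (8 * (L + 1)))"
    have L: "0 \<le> L" by (simp add: L_def arc_length_nonneg)
    have \<tau>: "\<tau> > 0" using e \<rho> L by (simp add: \<tau>_def)
    have \<tau>_le: "\<tau> \<le> 1/4" "\<tau> \<le> e * \<rho> / (8 * (L + 1))"
      unfolding \<tau>_def by (rule min.cobounded1, rule min.cobounded2)
    obtain d where d: "d > 0"
      "\<And>s s'. s \<in> {0..1} \<Longrightarrow> s' \<in> {0..1} \<Longrightarrow> dist s' s < d \<Longrightarrow> dist (q s') (q s) < \<tau>"
      using uc \<tau> unfolding uniformly_continuous_on_def by metis
    have "\<forall>\<^sub>F n in sequentially. 1 / real n < d"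
      using order_tendstoD(2)[OF lim_1_over_n d(1)] by simp
    moreover have "\<forall>\<^sub>F n in sequentially. n > (0::nat)" by (rule eventually_gt_at_top)
    ultimately show "\<forall>\<^sub>F n in sequentially. dist (\<Sum>i<n. edge n i / (vertex n i - z)) (2 * of_real pi * \<i> * winding_number \<gamma> z) < e"
    proof eventually_elim
      case (elim n)
      define \<delta> where "\<delta> i = q (real (Suc i) / n) - q (real i / n)" for i
      have step: "cmod (edge n i / (vertex n i - z) - \<delta> i) \<le> 4 * \<tau> / \<rho> * cmod (edge n i)" if i: "i < n" for i
      proof -
        have mem: "real i / n \<in> {0..1}" "real (Suc i) / n \<in> {0..1}" using i by auto
        have "real (Suc i) / n - real i / n = 1 / n" by (simp add: diff_divide_distrib[symmetric])
        then have "cmod (\<delta> i) < \<tau>"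
          using d(2)[OF mem] elim(1) by (simp add: \<delta>_def dist_norm)
        then have small: "cmod (\<delta> i) \<le> 1 / 4" "cmod (\<delta> i) \<le> \<tau>" using \<tau>_le(1) by auto
        have E: "edge n i / (vertex n i - z) = exp (\<delta> i) - 1"
          using exp_q[OF mem(1)] exp_q[OF mem(2)]
          by (simp add: edge_def vertex_def \<delta>_def exp_diff diff_divide_distrib)
        have T: "cmod (exp (\<delta> i) - 1 - \<delta> i) \<le> 2 * cmod (\<delta> i) * cmod (\<delta> i)"
          using norm_exp_minus_one_minus_le[OF small(1)] by (simp add: power2_eq_square mult.assoc)
        also have "\<dots> \<le> 2 * (1 / 4) * cmod (\<delta> i)" using small by (intro mult_right_mono) auto
        \<comment> \<open>The remainder is at most half of \<open>cmod (\<delta> i)\<close>, so the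
          linear term is controlled by \<open>exp (\<delta> i) - 1\<close>.\<close>
        finally have half: "cmod (\<delta> i) \<le> 2 * cmod (edge n i / (vertex n i - z))"
          unfolding E using norm_triangle_ineq3[of "\<delta> i" "exp (\<delta> i) - 1"] norm_minus_commute[of "\<delta> i" "exp (\<delta> i) - 1"]
          by linarith
        have "cmod (edge n i / (vertex n i - z)) \<le> cmod (edge n i) / \<rho>"
        proof -
          have "\<rho> \<le> cmod (vertex n i - z)"
            using \<rho>(2)[OF vertex_on_curve[of n i]] i by (simp add: dist_norm norm_minus_commute)
          then show ?thesis unfolding norm_divide using \<rho>(1) by (intro divide_left_mono mult_pos_pos) auto
        qed
        with half have \<delta>le: "cmod (\<delta> i) \<le> 2 * (cmod (edge n i) / \<rho>)" by linarith
        have "2 * cmod (\<delta> i) * cmod (\<delta> i) \<le> 2 * \<tau> * (2 * (cmod (edge n i) / \<rho>))"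
          using small \<delta>le \<tau> by (intro mult_mono) auto
        with T show ?thesis unfolding E by simp
      qed
      have "(\<Sum>i<n. \<delta> i) = q (real n / n) - q (real 0 / n)"
        unfolding \<delta>_def by (rule sum_lessThan_telescope)
      then have \<delta>sum: "(\<Sum>i<n. \<delta> i) = 2 * of_real pi * \<i> * winding_number \<gamma> z"
        using q(2) elim(2) by (simp add: pathfinish_def pathstart_def)
      have "cmod ((\<Sum>i<n. edge n i / (vertex n i - z)) - (\<Sum>i<n. \<delta> i)) \<le> (\<Sum>i<n. 4 * \<tau> / \<rho> * cmod (edge n i))"
        unfolding sum_subtractf[symmetric] by (rule sum_norm_le) (use step in simp)
      also have "\<dots> \<le> 4 * \<tau> / \<rho> * L"
        unfolding sum_distrib_left[symmetric] L_def
        using \<tau> \<rho>(1) by (intro mult_left_mono sum_edges_le_arc_length) auto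
      also have "\<dots> \<le> 4 * (e * \<rho> / (8 * (L + 1))) / \<rho> * L"
        using \<tau>_le(2) \<rho>(1) L by (intro mult_right_mono divide_right_mono mult_left_mono) auto
      also have "\<dots> = e * (L / (2 * (L + 1)))"
      proof -
        have cancel: "4 * (e * \<rho> / (8 * s)) / \<rho> * L = e * (L / (2 * s))" if "s \<noteq> 0" for s
          using \<rho>(1) that by (simp add: field_simps)
        show ?thesis by (rule cancel) (use L in simp)
      qed
      also have "\<dots> < e * 1" using e L by (intro mult_strict_left_mono) (auto simp: divide_less_eq)
      finally show ?case by (simp add: dist_norm \<delta>sum)
    qed
  qed
qed

end

section \<open>The modulus of continuity\<close>

lemma modulus_of_continuity_finite:
  assumes S: "compact S" and g: "continuous_on S (g :: complex \<Rightarrow> real)"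
  shows "modulus_of_continuity S g \<eta> < \<infinity>"
proof -
  have "bounded (g ` S)" using compact_continuous_image[OF g S] by (rule compact_imp_bounded)
  then obtain B where B: "\<And>t. t \<in> S \<Longrightarrow> \<bar>g t\<bar> \<le> B" by (auto simp: bounded_iff)
  have "modulus_of_continuity S g \<eta> \<le> ennreal (2 * B)"
    unfolding modulus_of_continuity_def
  proof (rule SUP_least, clarify)
    fix t1 t2 assume "t1 \<in> S" "t2 \<in> S"
    then show "ennreal (dist (g t1) (g t2)) \<le> ennreal (2 * B)"
      using B[of t1] B[of t2] by (intro ennreal_leI) (auto simp: dist_real_def)
  qed
  then show ?thesis by (rule le_less_trans) simp
qed

definition modulus :: "complex set \<Rightarrow> (complex \<Rightarrow> real) \<Rightarrow> real \<Rightarrow> real" where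
  "modulus S g \<eta> = enn2real (modulus_of_continuity S g \<eta>)"

lemma modulus_nonneg: "0 \<le> modulus S g \<eta>"
  by (simp add: modulus_def)

lemma modulus_mono:
  assumes "compact S" "continuous_on S g"
  shows "mono (modulus S g)"
proof (rule monoI)
  fix a b :: real assume "a \<le> b"
  then have "modulus_of_continuity S g a \<le> modulus_of_continuity S g b"
    unfolding modulus_of_continuity_def by (intro SUP_subset_mono) auto
  then show "modulus S g a \<le> modulus S g b"
    unfolding modulus_def using modulus_of_continuity_finite[OF assms] by (intro enn2real_mono) auto
qed

lemma ennreal_modulus:
  assumes "compact S" "continuous_on S g"
  shows "ennreal (modulus S g \<eta>) = modulus_of_continuity S g \<eta>"
  unfolding modulus_def using modulus_of_continuity_finite[OF assms] by simp

lemma diff_le_modulus: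
  assumes "compact S" "continuous_on S g" "s \<in> S" "t \<in> S" "cmod (s - t) \<le> \<eta>"
  shows "\<bar>g s - g t\<bar> \<le> modulus S g \<eta>"
proof -
  have "ennreal (dist (g s) (g t)) \<le> modulus_of_continuity S g \<eta>"
    unfolding modulus_of_continuity_def using assms by (intro SUP_upper2[of "(s, t)"]) auto
  then show ?thesis
    unfolding ennreal_modulus[OF assms(1,2), symmetric] by (simp add: dist_real_def modulus_nonneg)
qed

lemma modulus_tendsto_zero:
  assumes S: "compact S" "continuous_on S g" and e: "e > 0"
  obtains \<eta> where "\<eta> > 0" "modulus S g \<eta> \<le> e"
proof -
  have "uniformly_continuous_on S g" using S by (rule compact_uniformly_continuous[rotated])
  then obtain \<eta> where \<eta>: "\<eta> > 0" "\<And>s t. s \<in> S \<Longrightarrow> t \<in> S \<Longrightarrow> dist t s < \<eta> \<Longrightarrow> dist (g t) (g s) < e"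
    unfolding uniformly_continuous_on_def using e by metis
  have "modulus_of_continuity S g (\<eta> / 2) \<le> ennreal e"
    unfolding modulus_of_continuity_def
  proof (rule SUP_least, clarify)
    fix s t assume "s \<in> S" "t \<in> S" "cmod (s - t) \<le> \<eta> / 2"
    then show "ennreal (dist (g s) (g t)) \<le> ennreal e"
      using \<eta> by (intro ennreal_leI less_imp_le \<eta>(2)) (auto simp: dist_norm)
  qed
  then have "modulus S g (\<eta> / 2) \<le> e"
    unfolding ennreal_modulus[OF S, symmetric] using e by simp
  with \<eta>(1) show thesis by (intro that[of "\<eta> / 2"]) auto
qed

lemma modulus_le_diameter:
  assumes "compact S" "continuous_on S g"
  shows "modulus S g \<eta> \<le> modulus S g (diameter S)"
proof -
  have "modulus_of_continuity S g \<eta> \<le> modulus_of_continuity S g (diameter S)"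
    unfolding modulus_of_continuity_def
  proof (rule SUP_subset_mono, clarify)
    fix s t assume "s \<in> S" "t \<in> S"
    then show "cmod (s - t) \<le> diameter S"
      using diameter_bounded_bound[OF compact_imp_bounded[OF assms(1)]] by (simp add: dist_norm)
  qed simp
  then show ?thesis
    unfolding ennreal_modulus[OF assms, symmetric] by (simp add: modulus_nonneg)
qed

definition modulus_integral :: "complex set \<Rightarrow> (complex \<Rightarrow> real) \<Rightarrow> real \<Rightarrow> ennreal" where
  "modulus_integral S g \<epsilon> = (\<integral>\<^sup>+\<eta>\<in>{\<epsilon>..2 * diameter S}. ennreal (modulus S g \<eta> / \<eta>\<^sup>2) \<partial>lborel)"

lemma modulus_integral_antimono: "\<epsilon> \<le> \<epsilon>' \<Longrightarrow> modulus_integral S g \<epsilon>' \<le> modulus_integral S g \<epsilon>"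
  unfolding modulus_integral_def by (rule nn_integral_mono) (auto simp: indicator_def)

lemma modulus_le_modulus_integral:
  assumes S: "compact S" "continuous_on S g" and \<epsilon>: "0 < \<epsilon>" "\<epsilon> \<le> diameter S"
  shows "ennreal (modulus S g (4 * \<epsilon>)) \<le> ennreal (16 * \<epsilon>) * modulus_integral S g \<epsilon>"
proof -
  \<comment> \<open>Truncation at the diameter keeps \<open>{m..2*m}\<close> inside the range of
    integration and leaves the modulus unchanged.\<close>
  define m where "m = min (4 * \<epsilon>) (diameter S)"
  have m: "0 < m" "\<epsilon> \<le> m" "m \<le> 4 * \<epsilon>" "m \<le> diameter S" using \<epsilon> by (auto simp: m_def)
  have "modulus S g (4 * \<epsilon>) \<le> modulus S g m"
    using modulus_le_diameter[OF S, of "4 * \<epsilon>"] by (simp add: m_def min_def)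
  then have "ennreal (modulus S g (4 * \<epsilon>)) \<le> ennreal m * ennreal (modulus S g m / m)"
    using m(1) by (simp add: ennreal_mult[symmetric] modulus_nonneg)
  also have "\<dots> \<le> ennreal m * (ennreal 4 * (\<integral>\<^sup>+\<eta>\<in>{m..2*m}. ennreal (modulus S g \<eta> / \<eta>\<^sup>2) \<partial>lborel))"
    using mono_le_nn_integral[OF modulus_mono[OF S] modulus_nonneg m(1), of 2]
    by (intro mult_left_mono) simp_all
  also have "\<dots> \<le> ennreal m * (ennreal 4 * modulus_integral S g \<epsilon>)"
    unfolding modulus_integral_def using m
    by (intro mult_left_mono nn_integral_mono) (auto simp: indicator_def)
  also have "\<dots> = ennreal (m * 4) * modulus_integral S g \<epsilon>"
    using m(1) by (simp add: ennreal_mult mult.assoc)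
  also have "\<dots> \<le> ennreal (16 * \<epsilon>) * modulus_integral S g \<epsilon>"
    using m by (intro mult_right_mono ennreal_leI) auto
  finally show ?thesis .
qed

text \<open>Below \<open>\<eta>0\<close> the modulus is at most \<open>e / (2 * c)\<close>, and the
  integral of the inverse square from \<open>\<epsilon>\<close> on is \<open>1 / \<epsilon>\<close>,
  giving \<open>e / 2\<close>. Beyond \<open>\<eta>0\<close> the integral stays bounded by
  \<open>M / \<eta>0\<close> and is made small by the factor \<open>\<epsilon>\<close>. This yields
  the uniform continuity needed for the extension.\<close>

lemma modulus_integral_tendsto_zero:
  assumes S: "compact S" "continuous_on S g" and c: "c > 0" and e: "e > 0" and b: "b > 0"
  obtains \<epsilon> where "0 < \<epsilon>" "\<epsilon> \<le> b" "ennreal (c * \<epsilon>) * modulus_integral S g \<epsilon> \<le> ennreal e"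
proof -
  obtain \<eta>0 where \<eta>0: "\<eta>0 > 0" "modulus S g \<eta>0 \<le> e / (2 * c)"
    using modulus_tendsto_zero[OF S, of "e / (2 * c)"] c e by auto
  define M where "M = modulus S g (diameter S)"
  have M: "0 \<le> M" by (simp add: M_def modulus_nonneg)
  define \<epsilon> where "\<epsilon> = min b (e * \<eta>0 / (2 * c * (M + 1)))"
  have \<epsilon>: "0 < \<epsilon>" "\<epsilon> \<le> b" using b e c \<eta>0 M by (auto simp: \<epsilon>_def)
  have \<epsilon>2: "\<epsilon> \<le> e * \<eta>0 / (2 * c * (M + 1))" by (simp add: \<epsilon>_def)
  have "modulus_integral S g \<epsilon> \<le> (\<integral>\<^sup>+\<eta>. ennreal (e / (2 * c)) * (ennreal (1 / \<eta>\<^sup>2) * indicator {\<epsilon>..} \<eta>)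
      + ennreal M * (ennreal (1 / \<eta>\<^sup>2) * indicator {\<eta>0..} \<eta>) \<partial>lborel)"
    unfolding modulus_integral_def
  proof (rule nn_integral_mono)
    fix \<eta>
    have "modulus S g \<eta> \<le> e / (2 * c) + (if \<eta>0 \<le> \<eta> then M else 0)"
    proof (cases "\<eta>0 \<le> \<eta>")
      case True
      have "0 \<le> e / (2 * c)" using e c by simp
      then show ?thesis using True modulus_le_diameter[OF S, of \<eta>] by (simp add: M_def)
    next
      case False
      then show ?thesis using monoD[OF modulus_mono[OF S], of \<eta> \<eta>0] \<eta>0(2) by simp
    qed
    then have "modulus S g \<eta> / \<eta>\<^sup>2 \<le> (e / (2 * c) + (if \<eta>0 \<le> \<eta> then M else 0)) / \<eta>\<^sup>2"
      by (intro divide_right_mono) auto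
    also have "\<dots> = e / (2 * c) * (1 / \<eta>\<^sup>2) + (if \<eta>0 \<le> \<eta> then M else 0) * (1 / \<eta>\<^sup>2)"
      by (simp add: add_divide_distrib)
    finally have "ennreal (modulus S g \<eta> / \<eta>\<^sup>2)
        \<le> ennreal (e / (2 * c) * (1 / \<eta>\<^sup>2) + (if \<eta>0 \<le> \<eta> then M else 0) * (1 / \<eta>\<^sup>2))"
      by (rule ennreal_leI)
    also have "\<dots> = ennreal (e / (2 * c)) * ennreal (1 / \<eta>\<^sup>2) + ennreal (if \<eta>0 \<le> \<eta> then M else 0) * ennreal (1 / \<eta>\<^sup>2)"
      using e c M by (subst ennreal_plus) (auto simp: ennreal_mult[symmetric])
    finally show "ennreal (modulus S g \<eta> / \<eta>\<^sup>2) * indicator {\<epsilon>..2 * diameter S} \<eta>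
      \<le> ennreal (e / (2 * c)) * (ennreal (1 / \<eta>\<^sup>2) * indicator {\<epsilon>..} \<eta>)
      + ennreal M * (ennreal (1 / \<eta>\<^sup>2) * indicator {\<eta>0..} \<eta>)"
      by (cases "\<eta>0 \<le> \<eta>") (auto simp: indicator_def)
  qed
  also have "\<dots> = ennreal (e / (2 * c)) * ennreal (1 / \<epsilon>) + ennreal M * ennreal (1 / \<eta>0)"
    by (subst nn_integral_add) (simp_all add: nn_integral_cmult integral_inverse_square_atLeast \<epsilon>(1) \<eta>0(1))
  also have "\<dots> = ennreal (e / (2 * c) * (1 / \<epsilon>) + M * (1 / \<eta>0))"
    using e c M \<epsilon>(1) \<eta>0(1) by (subst ennreal_plus) (auto simp: ennreal_mult[symmetric])
  finally have "ennreal (c * \<epsilon>) * modulus_integral S g \<epsilon> \<le> ennreal (c * \<epsilon>) * ennreal (e / (2 * c) * (1 / \<epsilon>) + M * (1 / \<eta>0))"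
    by (rule mult_left_mono) simp
  also have "\<dots> = ennreal (c * \<epsilon> * (e / (2 * c) * (1 / \<epsilon>) + M * (1 / \<eta>0)))"
    using e c M \<epsilon>(1) \<eta>0(1) by (simp add: ennreal_mult)
  also have "\<dots> \<le> ennreal e"
  proof (rule ennreal_leI)
    have "c * \<epsilon> * (M * (1 / \<eta>0)) \<le> c * (e * \<eta>0 / (2 * c * (M + 1))) * (M * (1 / \<eta>0))"
      using \<epsilon>2 c M \<eta>0(1) by (intro mult_right_mono mult_left_mono) auto
    also have "\<dots> = e / 2 * (M / (M + 1))"
    proof -
      have "c * (e * \<eta>0 / (2 * c * s)) * (M * (1 / \<eta>0)) = e / 2 * (M / s)" if "s \<noteq> 0" for s
        using c \<eta>0(1) that by (simp add: field_simps)
      then show ?thesis using M by simp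
    qed
    also have "\<dots> \<le> e / 2 * 1" using e M by (intro mult_left_mono) auto
    finally have "c * \<epsilon> * (M * (1 / \<eta>0)) \<le> e / 2" by simp
    moreover have "c * \<epsilon> * (e / (2 * c) * (1 / \<epsilon>)) = e / 2" using c \<epsilon>(1) by simp
    ultimately show "c * \<epsilon> * (e / (2 * c) * (1 / \<epsilon>) + M * (1 / \<eta>0)) \<le> e"
      by (simp only: distrib_left)
  qed
  finally show thesis using \<epsilon> by (intro that)
qed

text \<open>With \<open>r\<close> the distance from \<open>v\<close> to \<open>x\<close>: since
  \<open>x\<close> is no further from \<open>z1\<close> than \<open>v\<close> is, \<open>v\<close>
  is at least \<open>r / 2\<close> away from \<open>z1\<close>; moving to \<open>z2\<close> costs at
  most \<open>\<epsilon> < r / 4\<close>. The factor 8 is the product of 2 and 4.\<close>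

lemma norm_diff_inverse_le:
  fixes v x z1 z2 :: complex
  assumes "cmod (z1 - z2) \<le> \<epsilon>" "4 * \<epsilon> < cmod (v - x)" "0 < \<epsilon>" "cmod (z1 - x) \<le> cmod (v - z1)"
  shows "cmod (1 / (v - z1) - 1 / (v - z2)) \<le> 8 * \<epsilon> / (cmod (v - x))\<^sup>2"
proof -
  define r where "r = cmod (v - x)"
  have "r \<le> cmod (v - z1) + cmod (z1 - x)"
    using norm_triangle_ineq[of "v - z1" "z1 - x"] by (simp add: r_def)
  then have 1: "r / 2 \<le> cmod (v - z1)" using assms(4) by simp
  have "cmod (v - z1) \<le> cmod (v - z2) + cmod (z1 - z2)"
    using norm_triangle_ineq[of "v - z2" "z2 - z1"] by (simp add: norm_minus_commute)
  then have 2: "r / 4 \<le> cmod (v - z2)" using 1 assms(1,2) by (simp add: r_def)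
  have r: "r > 0" using assms(2,3) unfolding r_def by linarith
  have "v \<noteq> z1" "v \<noteq> z2" using 1 2 r by auto
  then have "1 / (v - z1) - 1 / (v - z2) = (z1 - z2) / ((v - z1) * (v - z2))"
    by (simp add: field_simps)
  then have "cmod (1 / (v - z1) - 1 / (v - z2)) = cmod (z1 - z2) / (cmod (v - z1) * cmod (v - z2))"
    by (simp add: norm_divide norm_mult)
  also have "\<dots> \<le> \<epsilon> / (r / 2 * (r / 4))"
    using 1 2 r assms by (intro frac_le mult_mono) auto
  also have "\<dots> = 8 * \<epsilon> / r\<^sup>2" by (simp add: power2_eq_square)
  finally show ?thesis by (simp add: r_def)
qed

section \<open>The estimate for two points of the same domain\<close>

context Kral_Ahlfors_curve
begin

lemma compact_curve: "compact (path_image \<gamma>)"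
  using simple by (simp add: compact_simple_path_image)

text \<open>As 1/(2 pi i) = -i/(2 pi), taking the real part selects the imaginary part of the curve
  integral, to which the argument bounds apply.\<close>

lemma Re_cauchy_type_integral:
  "Re (cauchy_type_integral \<gamma> g z) = Im (curve_integral \<gamma> (\<lambda>t. of_real (g t) / (t - z))) / (2 * pi)"
proof -
  have "1 / (2 * of_real pi * \<i>) = of_real (1 / (2 * pi)) * (- \<i>)"
    by (simp add: field_simps)
  then show ?thesis by (simp add: cauchy_type_integral_def)
qed

lemma curve_integral_diff_bound:
  assumes g: "continuous_on (path_image \<gamma>) g"
    and z: "z1 \<notin> path_image \<gamma>" "z2 \<notin> path_image \<gamma>" "winding_number \<gamma> z1 = winding_number \<gamma> z2"
    and \<epsilon>: "0 < \<epsilon>" "cmod (z1 - z2) \<le> \<epsilon>"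
  defines "\<omega> \<equiv> modulus (path_image \<gamma>) g"
  shows "ennreal \<bar>Im (curve_integral \<gamma> (\<lambda>t. of_real (g t) / (t - z1)) - curve_integral \<gamma> (\<lambda>t. of_real (g t) / (t - z2)))\<bar>
     \<le> ennreal (\<omega> (4 * \<epsilon>) * (2 * (16 * C + 4 * V))) + ennreal (8 * \<epsilon>) * (ennreal (16 * C) * modulus_integral (path_image \<gamma>) g (4 * \<epsilon>))"
    (is "_ \<le> ?B")
proof -
  obtain x where x: "x \<in> path_image \<gamma>" "\<And>t. t \<in> path_image \<gamma> \<Longrightarrow> dist z1 x \<le> dist z1 t"
    using distance_attains_inf[OF compact_imp_closed[OF compact_curve]] by (metis path_image_nonempty)
  define k where "k t = 1 / (t - z1) - 1 / (t - z2)" for t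
  \<comment> \<open>Subtracting \<open>g x\<close> changes the limit by \<open>g x\<close> times the
    difference of two winding integrals, which vanishes by hypothesis.\<close>
  define S where "S n = (\<Sum>i<n. of_real (g (vertex n i) - g x) * k (vertex n i) * edge n i)" for n
  have lim: "S \<longlonglongrightarrow> curve_integral \<gamma> (\<lambda>t. of_real (g t) / (t - z1)) - curve_integral \<gamma> (\<lambda>t. of_real (g t) / (t - z2))"
  proof -
    have CI: "(\<lambda>n. \<Sum>i<n. of_real (g (vertex n i)) / (vertex n i - z) * edge n i) \<longlonglongrightarrow> curve_integral \<gamma> (\<lambda>t. of_real (g t) / (t - z))"
      if "z \<notin> path_image \<gamma>" for z
      using that g by (intro uniform_sums_tendsto_curve_integral continuous_intros) auto
    have "(\<lambda>n. ((\<Sum>i<n. of_real (g (vertex n i)) / (vertex n i - z1) * edge n i) - (\<Sum>i<n. of_real (g (vertex n i)) / (vertex n i - z2) * edge n i))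
          - of_real (g x) * ((\<Sum>i<n. edge n i / (vertex n i - z1)) - (\<Sum>i<n. edge n i / (vertex n i - z2))))
      \<longlonglongrightarrow> (curve_integral \<gamma> (\<lambda>t. of_real (g t) / (t - z1)) - curve_integral \<gamma> (\<lambda>t. of_real (g t) / (t - z2)))
          - of_real (g x) * (2 * of_real pi * \<i> * winding_number \<gamma> z1 - 2 * of_real pi * \<i> * winding_number \<gamma> z2)"
      by (intro tendsto_intros CI uniform_sums_tendsto_winding_number z)
    moreover have "((\<Sum>i<n. of_real (g (vertex n i)) / (vertex n i - z1) * edge n i) - (\<Sum>i<n. of_real (g (vertex n i)) / (vertex n i - z2) * edge n i))
          - of_real (g x) * ((\<Sum>i<n. edge n i / (vertex n i - z1)) - (\<Sum>i<n. edge n i / (vertex n i - z2))) = S n" for n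
      unfolding S_def k_def sum_subtractf[symmetric] sum_distrib_left
      by (rule sum.cong) (simp_all add: algebra_simps)
    ultimately show ?thesis using z(3) by simp
  qed
  \<comment> \<open>The mesh size is the splitting radius, as \<open>sum_edges_weighted_le\<close>
    asks.\<close>
  have "\<forall>\<^sub>F n in sequentially. fine_mesh n (4 * \<epsilon>)" using \<epsilon> by (intro eventually_fine_mesh) simp
  moreover note eventually_sum_Im_le[OF z(1)] eventually_sum_Im_le[OF z(2)]
  ultimately have "\<forall>\<^sub>F n in sequentially. ennreal \<bar>Im (S n)\<bar> \<le> ?B"
  proof eventually_elim
    case (elim n)
    note mesh = elim(1)
    have n: "n > 0" using mesh by (simp add: fine_mesh_def)
    define N where "N = {i. i < n \<and> cmod (vertex n i - x) \<le> 4 * \<epsilon>}"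
    define M where "M = {i. i < n \<and> 4 * \<epsilon> < cmod (vertex n i - x)}"
    have NM: "{..<n} = N \<union> M" "N \<inter> M = {}" "finite N" "finite M" by (auto simp: N_def M_def)
    define T where "T i = (g (vertex n i) - g x) * Im (k (vertex n i) * edge n i)" for i
    have S: "Im (S n) = sum T N + sum T M"
    proof -
      have "Im (S n) = sum T {..<n}"
        unfolding S_def T_def Im_sum by (rule sum.cong) (simp_all add: mult.assoc)
      then show ?thesis unfolding NM(1) using NM by (simp add: sum.union_disjoint)
    qed
    have dg: "\<bar>g (vertex n i) - g x\<bar> \<le> \<omega> \<eta>" if "i < n" "cmod (vertex n i - x) \<le> \<eta>" for i \<eta>
      unfolding \<omega>_def using that vertex_on_curve[OF n, of i] x(1)
      by (intro diff_le_modulus[OF compact_curve g]) auto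
    define J where "J z i = \<bar>Im (edge n i / (vertex n i - z))\<bar>" for z i
    have J: "sum (J z1) N \<le> 16 * C + 4 * V" "sum (J z2) N \<le> 16 * C + 4 * V"
    proof -
      have "sum (J z) N \<le> sum (J z) {..<n}" for z
        by (rule sum_mono2) (auto simp: N_def J_def)
      then show "sum (J z1) N \<le> 16 * C + 4 * V" "sum (J z2) N \<le> 16 * C + 4 * V"
        using elim(2,3) unfolding J_def by (meson order_trans)+
    qed
    \<comment> \<open>Near \<open>x\<close> the two kernels are not compared: each is bounded on its
      own by \<open>eventually_sum_Im_le\<close>, whose constant is the same for all poles. Hence
      the factor 2 in the bound.\<close>
    have "\<bar>sum T N\<bar> \<le> (\<Sum>i\<in>N. \<omega> (4 * \<epsilon>) * (J z1 i + J z2 i))"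
    proof (rule order_trans[OF sum_abs sum_mono])
      fix i assume i: "i \<in> N"
      have "k (vertex n i) * edge n i = edge n i / (vertex n i - z1) - edge n i / (vertex n i - z2)"
        by (simp add: k_def algebra_simps)
      then have "\<bar>Im (k (vertex n i) * edge n i)\<bar> \<le> J z1 i + J z2 i"
        unfolding J_def by (simp only: minus_complex.sel)
      then show "\<bar>T i\<bar> \<le> \<omega> (4 * \<epsilon>) * (J z1 i + J z2 i)"
        unfolding T_def abs_mult using dg[of i "4 * \<epsilon>"] i
        by (intro mult_mono) (auto simp: N_def \<omega>_def modulus_nonneg)
    qed
    also have "\<dots> = \<omega> (4 * \<epsilon>) * (sum (J z1) N + sum (J z2) N)"
      unfolding sum.distrib[symmetric] sum_distrib_left ..
    also have "\<dots> \<le> \<omega> (4 * \<epsilon>) * (2 * (16 * C + 4 * V))"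
      using J by (intro mult_left_mono) (auto simp: \<omega>_def modulus_nonneg)
    finally have near: "\<bar>sum T N\<bar> \<le> \<omega> (4 * \<epsilon>) * (2 * (16 * C + 4 * V))" .
    define W where "W = (\<Sum>i\<in>M. \<omega> (cmod (vertex n i - x)) / (cmod (vertex n i - x))\<^sup>2 * cmod (edge n i))"
    have "\<bar>sum T M\<bar> \<le> (\<Sum>i\<in>M. 8 * \<epsilon> * (\<omega> (cmod (vertex n i - x)) / (cmod (vertex n i - x))\<^sup>2 * cmod (edge n i)))"
    proof (rule order_trans[OF sum_abs sum_mono])
      fix i assume "i \<in> M"
      then have i: "i < n" "4 * \<epsilon> < cmod (vertex n i - x)" by (auto simp: M_def)
      have "cmod (z1 - x) \<le> cmod (vertex n i - z1)"
        using x(2)[OF vertex_on_curve[OF n, of i]] i(1) by (simp add: dist_norm norm_minus_commute)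
      then have "cmod (k (vertex n i)) \<le> 8 * \<epsilon> / (cmod (vertex n i - x))\<^sup>2"
        unfolding k_def using \<epsilon> i(2) by (intro norm_diff_inverse_le)
      then have "cmod (k (vertex n i) * edge n i) \<le> 8 * \<epsilon> / (cmod (vertex n i - x))\<^sup>2 * cmod (edge n i)"
        unfolding norm_mult by (rule mult_right_mono) simp
      then have "\<bar>Im (k (vertex n i) * edge n i)\<bar> \<le> 8 * \<epsilon> / (cmod (vertex n i - x))\<^sup>2 * cmod (edge n i)"
        using abs_Im_le_cmod order_trans by blast
      then have "\<bar>T i\<bar> \<le> \<omega> (cmod (vertex n i - x)) * (8 * \<epsilon> / (cmod (vertex n i - x))\<^sup>2 * cmod (edge n i))"
        unfolding T_def abs_mult using dg[OF i(1)]
        by (intro mult_mono) (auto simp: \<omega>_def modulus_nonneg)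
      then show "\<bar>T i\<bar> \<le> 8 * \<epsilon> * (\<omega> (cmod (vertex n i - x)) / (cmod (vertex n i - x))\<^sup>2 * cmod (edge n i))"
        by (simp add: mult_ac)
    qed
    also have "\<dots> = 8 * \<epsilon> * W" by (simp add: W_def sum_distrib_left)
    finally have far: "\<bar>sum T M\<bar> \<le> 8 * \<epsilon> * W" .
    have W0: "0 \<le> W" unfolding W_def by (intro sum_nonneg) (simp add: \<omega>_def modulus_nonneg)
    have "\<bar>Im (S n)\<bar> \<le> \<omega> (4 * \<epsilon>) * (2 * (16 * C + 4 * V)) + 8 * \<epsilon> * W"
      unfolding S using near far by linarith
    then have "ennreal \<bar>Im (S n)\<bar> \<le> ennreal (\<omega> (4 * \<epsilon>) * (2 * (16 * C + 4 * V)) + 8 * \<epsilon> * W)"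
      by (rule ennreal_leI)
    also have "\<dots> = ennreal (\<omega> (4 * \<epsilon>) * (2 * (16 * C + 4 * V))) + ennreal (8 * \<epsilon>) * ennreal W"
    proof -
      have "ennreal (8 * \<epsilon>) * ennreal W = ennreal (8 * \<epsilon> * W)" using \<epsilon> W0 by (simp add: ennreal_mult)
      moreover have "0 \<le> \<omega> (4 * \<epsilon>) * (2 * (16 * C + 4 * V))"
        using C_pos V_nonneg by (simp add: \<omega>_def modulus_nonneg)
      ultimately show ?thesis using W0 \<epsilon> by (simp only: ennreal_plus mult_nonneg_nonneg)
    qed
    also have "ennreal W \<le> ennreal (16 * C) * modulus_integral (path_image \<gamma>) g (4 * \<epsilon>)"
      unfolding W_def M_def modulus_integral_def \<omega>_def
      by (rule sum_edges_weighted_le[OF modulus_mono[OF compact_curve g] modulus_nonneg mesh x(1)]) (use \<epsilon> in simp)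
    finally show ?case by (simp add: add_left_mono mult_left_mono)
  qed
  moreover have "(\<lambda>n. ennreal \<bar>Im (S n)\<bar>) \<longlonglongrightarrow>
      ennreal \<bar>Im (curve_integral \<gamma> (\<lambda>t. of_real (g t) / (t - z1)) - curve_integral \<gamma> (\<lambda>t. of_real (g t) / (t - z2)))\<bar>"
    by (intro tendsto_intros lim)
  ultimately show ?thesis by (intro tendsto_upperbound) auto
qed

text \<open>Both terms are expressed by the integral at \<open>\<epsilon>\<close>: the near one
  through \<open>modulus_le_modulus_integral\<close>, the far one by enlarging the range. The
  constant is 16 * 2 * (16 C + 4 V) + 8 * 16 C.\<close>

lemma Re_cauchy_type_integral_diff_bound:
  assumes g: "continuous_on (path_image \<gamma>) g"
    and z: "z1 \<notin> path_image \<gamma>" "z2 \<notin> path_image \<gamma>" "winding_number \<gamma> z1 = winding_number \<gamma> z2"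
    and \<epsilon>: "0 < \<epsilon>" "cmod (z1 - z2) \<le> \<epsilon>" "\<epsilon> \<le> diameter (path_image \<gamma>)"
  shows "ennreal (dist (Re (cauchy_type_integral \<gamma> g z1)) (Re (cauchy_type_integral \<gamma> g z2)))
    \<le> ennreal ((640 * C + 128 * V) * \<epsilon>) * modulus_integral (path_image \<gamma>) g \<epsilon>"
proof -
  define F where "F z = curve_integral \<gamma> (\<lambda>t. of_real (g t) / (t - z))" for z
  define I where "I = modulus_integral (path_image \<gamma>) g"
  define K where "K = 2 * (16 * C + 4 * V)"
  have K: "0 \<le> K" using C_pos V_nonneg by (simp add: K_def)
  have "dist (Re (cauchy_type_integral \<gamma> g z1)) (Re (cauchy_type_integral \<gamma> g z2)) = \<bar>Im (F z1 - F z2)\<bar> / (2 * pi)"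
    by (simp add: Re_cauchy_type_integral F_def dist_real_def diff_divide_distrib[symmetric])
  also have "\<dots> \<le> \<bar>Im (F z1 - F z2)\<bar> / 1"
    using pi_ge_two by (intro divide_left_mono) auto
  finally have "ennreal (dist (Re (cauchy_type_integral \<gamma> g z1)) (Re (cauchy_type_integral \<gamma> g z2)))
      \<le> ennreal \<bar>Im (F z1 - F z2)\<bar>" by (intro ennreal_leI) simp
  also have "\<dots> \<le> ennreal (modulus (path_image \<gamma>) g (4 * \<epsilon>) * K) + ennreal (8 * \<epsilon>) * (ennreal (16 * C) * I (4 * \<epsilon>))"
    unfolding F_def K_def I_def by (rule curve_integral_diff_bound[OF g z \<epsilon>(1,2)])
  also have "\<dots> \<le> ennreal (16 * \<epsilon> * K) * I \<epsilon> + ennreal (8 * \<epsilon> * (16 * C)) * I \<epsilon>"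
  proof (rule add_mono)
    have "ennreal (modulus (path_image \<gamma>) g (4 * \<epsilon>) * K) = ennreal K * ennreal (modulus (path_image \<gamma>) g (4 * \<epsilon>))"
      using K by (simp add: ennreal_mult modulus_nonneg mult.commute)
    also have "\<dots> \<le> ennreal K * (ennreal (16 * \<epsilon>) * I \<epsilon>)"
      unfolding I_def by (intro mult_left_mono modulus_le_modulus_integral compact_curve g \<epsilon>) simp
    also have "\<dots> = ennreal (16 * \<epsilon> * K) * I \<epsilon>"
      using K \<epsilon>(1) by (simp add: ennreal_mult mult_ac)
    finally show "ennreal (modulus (path_image \<gamma>) g (4 * \<epsilon>) * K) \<le> ennreal (16 * \<epsilon> * K) * I \<epsilon>" .
    have "ennreal (8 * \<epsilon>) * (ennreal (16 * C) * I (4 * \<epsilon>)) \<le> ennreal (8 * \<epsilon>) * (ennreal (16 * C) * I \<epsilon>)"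
      unfolding I_def using \<epsilon>(1) by (intro mult_left_mono modulus_integral_antimono) auto
    also have "\<dots> = ennreal (8 * \<epsilon> * (16 * C)) * I \<epsilon>"
      using C_pos \<epsilon>(1) by (simp add: ennreal_mult mult_ac)
    finally show "ennreal (8 * \<epsilon>) * (ennreal (16 * C) * I (4 * \<epsilon>)) \<le> ennreal (8 * \<epsilon> * (16 * C)) * I \<epsilon>" .
  qed
  also have "\<dots> = ennreal (16 * \<epsilon> * K + 8 * \<epsilon> * (16 * C)) * I \<epsilon>"
    using K C_pos \<epsilon>(1) by (simp add: distrib_right[symmetric] ennreal_plus[symmetric] del: ennreal_plus)
  also have "16 * \<epsilon> * K + 8 * \<epsilon> * (16 * C) = (640 * C + 128 * V) * \<epsilon>"
    by (simp add: K_def algebra_simps)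
  finally show ?thesis by (simp add: I_def)
qed

end

section \<open>Extension to the closed domain\<close>

text \<open>Points of the closure at distance at most \<open>\<epsilon>\<close> are limits of points
  of \<open>D\<close> whose distance may exceed \<open>\<epsilon>\<close> but is eventually below
  \<open>2 * \<epsilon>\<close>; hence the bound at \<open>2 * \<epsilon>\<close>.\<close>

lemma modulus_of_continuity_continuous_extension:
  fixes f :: "complex \<Rightarrow> real" and G :: "real \<Rightarrow> ennreal"
  assumes bound: "\<And>z1 z2 \<epsilon>. z1 \<in> D \<Longrightarrow> z2 \<in> D \<Longrightarrow> 0 < \<epsilon> \<Longrightarrow> \<epsilon> \<le> b \<Longrightarrow> cmod (z1 - z2) \<le> \<epsilon> \<Longrightarrow>
      ennreal (dist (f z1) (f z2)) \<le> G \<epsilon>"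
    and small: "\<And>e. e > 0 \<Longrightarrow> \<exists>\<epsilon>>0. \<epsilon> \<le> b \<and> G \<epsilon> \<le> ennreal e"
    and \<epsilon>: "0 < \<epsilon>" "2 * \<epsilon> \<le> b"
  shows "modulus_of_continuity (closure D) (continuous_extension D f) \<epsilon> \<le> G (2 * \<epsilon>)"
proof -
  have "uniformly_continuous_on D f"
    unfolding uniformly_continuous_on_def
  proof (intro allI impI)
    fix e :: real assume e: "e > 0"
    then obtain \<delta> where \<delta>: "\<delta> > 0" "\<delta> \<le> b" "G \<delta> \<le> ennreal (e / 2)" using small[of "e / 2"] by auto
    have "dist (f z2) (f z1) < e" if "z1 \<in> D" "z2 \<in> D" "dist z2 z1 < \<delta>" for z1 z2
    proof -
      have "ennreal (dist (f z2) (f z1)) \<le> ennreal (e / 2)"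
        using bound[OF that(2,1) \<delta>(1,2)] that(3) \<delta>(3) by (auto simp: dist_norm intro: order_trans)
      then have "dist (f z2) (f z1) \<le> e / 2" using e by simp
      then show ?thesis using e by simp
    qed
    then show "\<exists>d>0. \<forall>x\<in>D. \<forall>x'\<in>D. dist x' x < d \<longrightarrow> dist (f x') (f x) < e"
      using \<delta>(1) by blast
  qed
  then obtain h where h: "uniformly_continuous_on (closure D) h" "\<And>z. z \<in> D \<Longrightarrow> f z = h z"
    using uniformly_continuous_on_extension_on_closure by metis
  have cont_h: "continuous_on (closure D) h" using h(1) by (rule uniformly_continuous_imp_continuous)
  have ext: "continuous_extension D f z = h z" if z: "z \<in> closure D" for z
  proof (cases "z \<in> D")
    case False
    have "(h \<longlongrightarrow> h z) (at z within closure D)" using cont_h z by (simp add: continuous_on)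
    then have "(h \<longlongrightarrow> h z) (at z within D)" by (rule tendsto_within_subset) (rule closure_subset)
    moreover have "\<forall>\<^sub>F t in at z within D. h t = f t"
      unfolding eventually_at_filter using h(2) by (simp add: eventually_at_topological)
    ultimately have lim: "(f \<longlongrightarrow> h z) (at z within D)" by (rule Lim_transform_eventually)
    \<comment> \<open>A closure point outside \<open>D\<close> is a limit point of \<open>D\<close>,
      so \<open>Lim\<close> is determined.\<close>
    have "at z within D \<noteq> bot"
      using z False by (auto simp: trivial_limit_within closure_def)
    then show ?thesis using False lim by (simp add: continuous_extension_def tendsto_Lim)
  qed (simp add: continuous_extension_def h(2))
  show ?thesis
    unfolding modulus_of_continuity_def
  proof (rule SUP_least, clarify)
    fix t1 t2 assume t: "t1 \<in> closure D" "t2 \<in> closure D" "cmod (t1 - t2) \<le> \<epsilon>"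
    obtain X where X: "\<And>n. X n \<in> D" "X \<longlonglongrightarrow> t1" using t(1) unfolding closure_sequential by blast
    obtain Y where Y: "\<And>n. Y n \<in> D" "Y \<longlonglongrightarrow> t2" using t(2) unfolding closure_sequential by blast
    have "(\<lambda>n. cmod (X n - Y n)) \<longlonglongrightarrow> cmod (t1 - t2)" by (intro tendsto_intros X Y)
    then have "\<forall>\<^sub>F n in sequentially. cmod (X n - Y n) < 2 * \<epsilon>"
      using t(3) \<epsilon>(1) by (intro order_tendstoD(2)) auto
    then have "\<forall>\<^sub>F n in sequentially. ennreal (dist (h (X n)) (h (Y n))) \<le> G (2 * \<epsilon>)"
    proof eventually_elim
      case (elim n)
      then show ?case using bound[OF X(1) Y(1), of "2 * \<epsilon>" n n] \<epsilon> h(2) X(1) Y(1) by simp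
    qed
    moreover have "(\<lambda>n. ennreal (dist (h (X n)) (h (Y n)))) \<longlonglongrightarrow> ennreal (dist (h t1) (h t2))"
    proof -
      have "(\<lambda>n. h (X n)) \<longlonglongrightarrow> h t1"
        using X(1) closure_subset[of D]
        by (intro continuous_on_tendsto_compose[OF cont_h X(2) t(1)] always_eventually allI) blast
      moreover have "(\<lambda>n. h (Y n)) \<longlonglongrightarrow> h t2"
        using Y(1) closure_subset[of D]
        by (intro continuous_on_tendsto_compose[OF cont_h Y(2) t(2)] always_eventually allI) blast
      ultimately show ?thesis by (intro tendsto_intros)
    qed
    ultimately have "ennreal (dist (h t1) (h t2)) \<le> G (2 * \<epsilon>)" by (intro tendsto_upperbound) auto
    then show "ennreal (dist (continuous_extension D f t1) (continuous_extension D f t2)) \<le> G (2 * \<epsilon>)"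
      using ext t by simp
  qed
qed

theorem theorem2:
  fixes \<gamma> :: "real \<Rightarrow> complex" and d :: real
  assumes "rectifiable_Jordan_curve \<gamma>"
    and "counterclockwise \<gamma>"
    and "d = diameter (path_image \<gamma>)"
    and "Ahlfors_regular \<gamma>"
    and "Kral_curve \<gamma>"
  shows "\<exists>c>0. \<forall>g :: complex \<Rightarrow> real. continuous_on (path_image \<gamma>) g \<longrightarrow>
           (\<forall>D \<in> {inside (path_image \<gamma>), outside (path_image \<gamma>)}. \<forall>\<epsilon>. 0 < \<epsilon> \<and> \<epsilon> \<le> d / 8 \<longrightarrow>
              modulus_of_continuity (closure D)
                (continuous_extension D (\<lambda>z. Re (cauchy_type_integral \<gamma> g z))) \<epsilon>
              \<le> ennreal (c * \<epsilon>) *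
                 (\<integral>\<^sup>+ \<eta> \<in> {\<epsilon>..2 * d}. (modulus_of_continuity (path_image \<gamma>) g \<eta> / ennreal (\<eta>\<^sup>2)) \<partial>lborel))"
proof -
  interpret rectifiable_curve \<gamma> by unfold_locales (rule assms(1))
  obtain C where C: "C > 0" "\<And>x r. x \<in> path_image \<gamma> \<Longrightarrow> r > 0 \<Longrightarrow> mes \<gamma> (curve_nbhd \<gamma> r x) \<le> C * r"
    using Ahlfors_regular_bound[OF assms(4)] by metis
  obtain a where a: "\<And>\<xi>. \<xi> \<in> path_image \<gamma> \<Longrightarrow> arg_branch \<gamma> \<xi> (a \<xi>)"
    "(SUP \<xi> \<in> path_image \<gamma>. punctured_variation \<gamma> \<xi> (a \<xi>)) < \<infinity>"
    using assms(5) unfolding Kral_curve_def by blast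
  define V where "V = enn2real (SUP \<xi> \<in> path_image \<gamma>. punctured_variation \<gamma> \<xi> (a \<xi>))"
  have V: "punctured_variation \<gamma> \<xi> (a \<xi>) \<le> ennreal V" if "\<xi> \<in> path_image \<gamma>" for \<xi>
  proof -
    have "punctured_variation \<gamma> \<xi> (a \<xi>) \<le> (SUP \<xi> \<in> path_image \<gamma>. punctured_variation \<gamma> \<xi> (a \<xi>))"
      using that by (rule SUP_upper)
    then show ?thesis using a(2) by (simp add: V_def)
  qed
  interpret Kral_Ahlfors_curve \<gamma> C V
  proof unfold_locales
    show "0 \<le> V" by (simp add: V_def)
    show "\<exists>b. arg_branch \<gamma> \<xi> b \<and> punctured_variation \<gamma> \<xi> b \<le> ennreal V" if "\<xi> \<in> path_image \<gamma>" for \<xi>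
      using a(1) V that by blast
  qed (use C in auto)
  \<comment> \<open>The constant for the open domain; passing to the closure at
    \<open>2 * \<epsilon>\<close> doubles it.\<close>
  define c where "c = 640 * C + 128 * V"
  have c: "c > 0" using C(1) V_nonneg by (simp add: c_def)
  have "modulus_of_continuity (closure D) (continuous_extension D (\<lambda>z. Re (cauchy_type_integral \<gamma> g z))) \<epsilon>
      \<le> ennreal (2 * c * \<epsilon>) *
         (\<integral>\<^sup>+ \<eta> \<in> {\<epsilon>..2 * d}. (modulus_of_continuity (path_image \<gamma>) g \<eta> / ennreal (\<eta>\<^sup>2)) \<partial>lborel)"
    if g: "continuous_on (path_image \<gamma>) g" and D: "D \<in> {inside (path_image \<gamma>), outside (path_image \<gamma>)}"
      and \<epsilon>: "0 < \<epsilon>" "\<epsilon> \<le> d / 8" for g D \<epsilon>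
  proof -
    have off: "z \<notin> path_image \<gamma>" if "z \<in> D" for z
      using D that by (auto simp: inside_def outside_def)
    \<comment> \<open>The winding number is 1 inside by the orientation and 0 outside.\<close>
    have wind: "winding_number \<gamma> z1 = winding_number \<gamma> z2" if "z1 \<in> D" "z2 \<in> D" for z1 z2
      using D that assms(2) simple closed_curve
      by (auto simp: counterclockwise_def winding_number_zero_in_outside simple_path_imp_path)
    have "modulus_of_continuity (closure D) (continuous_extension D (\<lambda>z. Re (cauchy_type_integral \<gamma> g z))) \<epsilon>
        \<le> ennreal (c * (2 * \<epsilon>)) * modulus_integral (path_image \<gamma>) g (2 * \<epsilon>)"
    proof (rule modulus_of_continuity_continuous_extension[where b = d and G = "\<lambda>\<epsilon>. ennreal (c * \<epsilon>) * modulus_integral (path_image \<gamma>) g \<epsilon>"])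
      fix z1 z2 \<epsilon>' assume "z1 \<in> D" "z2 \<in> D" "0 < \<epsilon>'" "\<epsilon>' \<le> d" "cmod (z1 - z2) \<le> \<epsilon>'"
      then show "ennreal (dist (Re (cauchy_type_integral \<gamma> g z1)) (Re (cauchy_type_integral \<gamma> g z2)))
          \<le> ennreal (c * \<epsilon>') * modulus_integral (path_image \<gamma>) g \<epsilon>'"
        unfolding c_def assms(3) by (intro Re_cauchy_type_integral_diff_bound g off wind)
    next
      fix e :: real assume "e > 0"
      then show "\<exists>\<epsilon>>0. \<epsilon> \<le> d \<and> ennreal (c * \<epsilon>) * modulus_integral (path_image \<gamma>) g \<epsilon> \<le> ennreal e"
        using modulus_integral_tendsto_zero[OF compact_curve g c, of e d] \<epsilon> by auto
    qed (use \<epsilon> in auto)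
    also have "\<dots> \<le> ennreal (2 * c * \<epsilon>) * modulus_integral (path_image \<gamma>) g \<epsilon>"
      using \<epsilon>(1) by (intro mult_mono modulus_integral_antimono) (auto simp: mult_ac)
    also have "modulus_integral (path_image \<gamma>) g \<epsilon> =
        (\<integral>\<^sup>+ \<eta> \<in> {\<epsilon>..2 * d}. (modulus_of_continuity (path_image \<gamma>) g \<eta> / ennreal (\<eta>\<^sup>2)) \<partial>lborel)"
      unfolding modulus_integral_def assms(3)
    proof (rule nn_integral_cong)
      fix \<eta>
      show "ennreal (modulus (path_image \<gamma>) g \<eta> / \<eta>\<^sup>2) * indicator {\<epsilon>..2 * diameter (path_image \<gamma>)} \<eta>
          = modulus_of_continuity (path_image \<gamma>) g \<eta> / ennreal (\<eta>\<^sup>2) * indicator {\<epsilon>..2 * diameter (path_image \<gamma>)} \<eta>"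
      proof (cases "\<epsilon> \<le> \<eta>")
        \<comment> \<open>Positivity of the denominator is what makes division in the extended reals
          agree with real division.\<close>
        case True
        then have "0 < \<eta>\<^sup>2" using \<epsilon>(1) by simp
        then show ?thesis
          unfolding ennreal_modulus[OF compact_curve g, symmetric]
          by (simp add: divide_ennreal modulus_nonneg)
      qed simp
    qed
    finally show ?thesis .
  qed
  then show ?thesis using c by (intro exI[of _ "2 * c"]) auto
qed

end
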